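(* Let $\{Q_i\}_{i\in I}$ be a family of residually finite quandles. If the associated group $\operatorname{As}(Q_i)$ is a residually finite group for each $i\in I$, then the free product $\star_{i\in I}Q_i$ is a residually finite quandle.
   Context: A quandle is a non-empty set $X$ with a binary operation $*$ such that: (1) $x*x=x$ for all $x\in X$; (2) for any $x,y\in X$ there is a unique $z\in X$ with $x=z*y$; (3) $(x*y)*z=(x*z)*(y*z)$ for all $x,y,z\in X$. A quandle homomorphism is a map preserving $*$. A quandle $X$ is residually finite if for all $x,y\in X$ with $x\neq y$ there exist a finite quandle $F$ and a quandle homomorphism $\phi:X\to F$ with $\phi(x)\neq\phi(y)$. The associated group $\operatorname{As}(X)$ of a quandle $X$ is the group generated by the set $\{e_x\mid x\in X\}$ modulo the relations $e_{x*y}=e_y^{-1}e_xe_y$ for all $x,y\in X$. Free product: if quandles $Q_i$ ($i\in I$, $I$ non-empty) have quandle presentations $Q_i=\langle X_i\mid R_i\rangle$ with pairwise disjoint generating sets, then $\star_{i\in I}Q_i$ is the quandle with presentation $\langle \bigsqcup_{i\in I}X_i\mid\bigsqcup_{i\in I}R_i\rangle$ (equivalently, the coproduct of the $Q_i$ in the category of quandles). Here $\langle X\mid R\rangle$ denotes the quotient of the free quandle on $X$ by the smallest congruence containing the relations $R$. *)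

theory Defs
  imports "HOL-Algebra.Group" "HOL-Library.Disjoint_Sets"
begin

record 'a quandle = "'a partial_object" +
  qop :: "'a \<Rightarrow> 'a \<Rightarrow> 'a" (infixl \<open>\<star>\<index>\<close> 70)

locale quandle =
  fixes Q (structure)
  assumes carrier_nonempty: "carrier Q \<noteq> {}"
    and qop_closed: "\<lbrakk>x \<in> carrier Q; y \<in> carrier Q\<rbrakk> \<Longrightarrow> x \<star> y \<in> carrier Q"
    and qop_idem: "x \<in> carrier Q \<Longrightarrow> x \<star> x = x"
    and qop_unique_div: "\<lbrakk>x \<in> carrier Q; y \<in> carrier Q\<rbrakk> \<Longrightarrow> \<exists>!z. z \<in> carrier Q \<and> x = z \<star> y"
    and qop_distrib: "\<lbrakk>x \<in> carrier Q; y \<in> carrier Q; z \<in> carrier Q\<rbrakk>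
      \<Longrightarrow> (x \<star> y) \<star> z = (x \<star> z) \<star> (y \<star> z)"

definition quandle_div :: "('a, 'm) quandle_scheme \<Rightarrow> 'a \<Rightarrow> 'a \<Rightarrow> 'a" where
  "quandle_div Q x y = (THE z. z \<in> carrier Q \<and> x = z \<star>\<^bsub>Q\<^esub> y)"

definition quandle_hom :: "('a, 'm) quandle_scheme \<Rightarrow> ('b, 'n) quandle_scheme \<Rightarrow> ('a \<Rightarrow> 'b) set" where
  "quandle_hom Q Q' = {f \<in> carrier Q \<rightarrow> carrier Q'.
     \<forall>x\<in>carrier Q. \<forall>y\<in>carrier Q. f (x \<star>\<^bsub>Q\<^esub> y) = f x \<star>\<^bsub>Q'\<^esub> f y}"

definition quandle_iso :: "('a, 'm) quandle_scheme \<Rightarrow> ('b, 'n) quandle_scheme \<Rightarrow> ('a \<Rightarrow> 'b) set" where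
  "quandle_iso Q Q' = {f \<in> quandle_hom Q Q'. bij_betw f (carrier Q) (carrier Q')}"

text \<open>
  Every finite quandle (group) is isomorphic to one whose carrier is a finite set of natural
  numbers, so restricting the targets to carriers in \<^typ>\<open>nat\<close> loses no generality.
\<close>

definition residually_finite_quandle :: "('a, 'm) quandle_scheme \<Rightarrow> bool" where
  "residually_finite_quandle Q \<longleftrightarrow> quandle Q \<and>
     (\<forall>x\<in>carrier Q. \<forall>y\<in>carrier Q. x \<noteq> y \<longrightarrow>
       (\<exists>(F :: nat quandle) \<phi>. quandle F \<and> finite (carrier F) \<and>
          \<phi> \<in> quandle_hom Q F \<and> \<phi> x \<noteq> \<phi> y))"

definition residually_finite_group :: "('a, 'm) monoid_scheme \<Rightarrow> bool" where
  "residually_finite_group G \<longleftrightarrow> group G \<and>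
     (\<forall>g\<in>carrier G. g \<noteq> \<one>\<^bsub>G\<^esub> \<longrightarrow>
       (\<exists>(F :: nat monoid) \<phi>. group F \<and> finite (carrier F) \<and>
          \<phi> \<in> hom G F \<and> \<phi> g \<noteq> \<one>\<^bsub>F\<^esub>))"

text \<open>
  Group words over \<open>S\<close> are lists of letters: \<open>(True, x)\<close> stands for the generator \<open>x\<close> and
  \<open>(False, x)\<close> for its inverse.
\<close>

definition group_words :: "'g set \<Rightarrow> (bool \<times> 'g) list set" where
  "group_words S = lists (UNIV \<times> S)"

inductive_set group_word_rel ::
    "'g set \<Rightarrow> ((bool \<times> 'g) list \<times> (bool \<times> 'g) list) set
      \<Rightarrow> ((bool \<times> 'g) list \<times> (bool \<times> 'g) list) set"
  for S R where
  gw_refl: "u \<in> group_words S \<Longrightarrow> (u, u) \<in> group_word_rel S R"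
| gw_sym: "(u, v) \<in> group_word_rel S R \<Longrightarrow> (v, u) \<in> group_word_rel S R"
| gw_trans: "\<lbrakk>(u, v) \<in> group_word_rel S R; (v, w) \<in> group_word_rel S R\<rbrakk>
    \<Longrightarrow> (u, w) \<in> group_word_rel S R"
| gw_append: "\<lbrakk>(u, u') \<in> group_word_rel S R; (v, v') \<in> group_word_rel S R\<rbrakk>
    \<Longrightarrow> (u @ v, u' @ v') \<in> group_word_rel S R"
| gw_cancel: "x \<in> S \<Longrightarrow> ([(b, x), (\<not> b, x)], []) \<in> group_word_rel S R"
| gw_relator: "\<lbrakk>(u, v) \<in> R; u \<in> group_words S; v \<in> group_words S\<rbrakk>
    \<Longrightarrow> (u, v) \<in> group_word_rel S R"

definition presented_group ::
    "'g set \<Rightarrow> ((bool \<times> 'g) list \<times> (bool \<times> 'g) list) set \<Rightarrow> (bool \<times> 'g) list set monoid" where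
  "presented_group S R =
     \<lparr>carrier = group_words S // group_word_rel S R,
      mult = (\<lambda>A B. \<Union>u\<in>A. \<Union>v\<in>B. group_word_rel S R `` {u @ v}),
      one = group_word_rel S R `` {[]}\<rparr>"

text \<open>The generator \<open>e\<^sub>x\<close> is the class of \<open>[(True, x)]\<close>.\<close>

definition associated_group :: "('a, 'm) quandle_scheme \<Rightarrow> (bool \<times> 'a) list set monoid" where
  "associated_group Q = presented_group (carrier Q)
     {([(True, x \<star>\<^bsub>Q\<^esub> y)], [(False, y), (True, x), (True, y)]) | x y.
        x \<in> carrier Q \<and> y \<in> carrier Q}"

text \<open>
  The free quandle on \<open>X\<close> is the term algebra over \<open>X\<close> modulo the quandle laws. Unique right division is
  made equational by a second operation symbol \<open>QDiv\<close>, where \<open>QDiv s t\<close> denotes the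
  unique \<open>z\<close> with \<open>s = z \<star> t\<close>.
\<close>

datatype (qgens: 'g) qterm = QGen 'g | QOp "'g qterm" "'g qterm" | QDiv "'g qterm" "'g qterm"

definition qterms :: "'g set \<Rightarrow> 'g qterm set" where
  "qterms X = {t. qgens t \<subseteq> X}"

inductive_set free_quandle_rel :: "'g set \<Rightarrow> ('g qterm \<times> 'g qterm) set" for X where
  fq_refl: "t \<in> qterms X \<Longrightarrow> (t, t) \<in> free_quandle_rel X"
| fq_sym: "(s, t) \<in> free_quandle_rel X \<Longrightarrow> (t, s) \<in> free_quandle_rel X"
| fq_trans: "\<lbrakk>(s, t) \<in> free_quandle_rel X; (t, u) \<in> free_quandle_rel X\<rbrakk>
    \<Longrightarrow> (s, u) \<in> free_quandle_rel X"
| fq_op: "\<lbrakk>(s, s') \<in> free_quandle_rel X; (t, t') \<in> free_quandle_rel X\<rbrakk>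
    \<Longrightarrow> (QOp s t, QOp s' t') \<in> free_quandle_rel X"
| fq_div: "\<lbrakk>(s, s') \<in> free_quandle_rel X; (t, t') \<in> free_quandle_rel X\<rbrakk>
    \<Longrightarrow> (QDiv s t, QDiv s' t') \<in> free_quandle_rel X"
| fq_idem: "t \<in> qterms X \<Longrightarrow> (QOp t t, t) \<in> free_quandle_rel X"
| fq_div_op: "\<lbrakk>s \<in> qterms X; t \<in> qterms X\<rbrakk> \<Longrightarrow> (QDiv (QOp s t) t, s) \<in> free_quandle_rel X"
| fq_op_div: "\<lbrakk>s \<in> qterms X; t \<in> qterms X\<rbrakk> \<Longrightarrow> (QOp (QDiv s t) t, s) \<in> free_quandle_rel X"
| fq_distrib: "\<lbrakk>s \<in> qterms X; t \<in> qterms X; u \<in> qterms X\<rbrakk>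
    \<Longrightarrow> (QOp (QOp s t) u, QOp (QOp s u) (QOp t u)) \<in> free_quandle_rel X"

definition free_quandle :: "'g set \<Rightarrow> 'g qterm set quandle" where
  "free_quandle X =
     \<lparr>carrier = qterms X // free_quandle_rel X,
      qop = (\<lambda>A B. \<Union>s\<in>A. \<Union>t\<in>B. free_quandle_rel X `` {QOp s t})\<rparr>"

text \<open>
  A congruence has to respect \<^const>\<open>quandle_div\<close> as well: for an infinite quandle,
  compatibility with the quandle operation alone does not make right division unique in
  the quotient.
\<close>

definition quandle_congruence :: "('a, 'm) quandle_scheme \<Rightarrow> ('a \<times> 'a) set \<Rightarrow> bool" where
  "quandle_congruence Q \<theta> \<longleftrightarrow> equiv (carrier Q) \<theta> \<and>
     (\<forall>(x, x')\<in>\<theta>. \<forall>(y, y')\<in>\<theta>.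
        (x \<star>\<^bsub>Q\<^esub> y, x' \<star>\<^bsub>Q\<^esub> y') \<in> \<theta> \<and> (quandle_div Q x y, quandle_div Q x' y') \<in> \<theta>)"

definition generated_congruence :: "('a, 'm) quandle_scheme \<Rightarrow> ('a \<times> 'a) set \<Rightarrow> ('a \<times> 'a) set" where
  "generated_congruence Q R = \<Inter>{\<theta>. quandle_congruence Q \<theta> \<and> R \<subseteq> \<theta>}"

definition quotient_quandle :: "('a, 'm) quandle_scheme \<Rightarrow> ('a \<times> 'a) set \<Rightarrow> 'a set quandle" where
  "quotient_quandle Q \<theta> =
     \<lparr>carrier = carrier Q // \<theta>,
      qop = (\<lambda>A B. \<Union>x\<in>A. \<Union>y\<in>B. \<theta> `` {x \<star>\<^bsub>Q\<^esub> y})\<rparr>"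

text \<open>
  Relations are given by pairs of terms over the generators, each term representing its class in
  the free quandle. Thus the relations of the factors of a free product can be
  collected by a plain union.
\<close>

definition presented_quandle ::
    "'g set \<Rightarrow> ('g qterm \<times> 'g qterm) set \<Rightarrow> 'g qterm set set quandle" where
  "presented_quandle X R = quotient_quandle (free_quandle X)
     (generated_congruence (free_quandle X)
        {(free_quandle_rel X `` {s}, free_quandle_rel X `` {t}) | s t. (s, t) \<in> R})"

definition quandle_presentation ::
    "('a, 'm) quandle_scheme \<Rightarrow> 'g set \<Rightarrow> ('g qterm \<times> 'g qterm) set \<Rightarrow> bool" where
  "quandle_presentation Q X R \<longleftrightarrow>
     R \<subseteq> qterms X \<times> qterms X \<and> quandle_iso Q (presented_quandle X R) \<noteq> {}"

text \<open>
  This is the free product only for pairwise disjoint generating sets \<open>X i\<close>; disjointness is a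
  hypothesis wherever it is used.
\<close>

definition quandle_free_product ::
    "'i set \<Rightarrow> ('i \<Rightarrow> 'g set) \<Rightarrow> ('i \<Rightarrow> ('g qterm \<times> 'g qterm) set) \<Rightarrow> 'g qterm set set quandle" where
  "quandle_free_product I X R = presented_quandle (\<Union>i\<in>I. X i) (\<Union>i\<in>I. R i)"

end

theory Submission
  imports Defs "HOL-Algebra.Product_Groups" "HOL-Combinatorics.Permutations"
begin

text \<open>
  The associated group \<open>As(Q\<^sub>i)\<close> acts on any quandle that receives a homomorphism from
  \<open>Q\<^sub>i\<close>, the generator \<open>e\<^sub>x\<close> acting as the right translation by the image of \<open>x\<close>. In the
  free product, every element arises from a base point \<open>y\<close> in some \<open>Q\<^sub>i\<close> by acting with finitely
  many syllables, that is, elements of the groups \<open>As(Q\<^sub>j)\<close>. Syllables can be merged, dropped if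
  trivial, or absorbed into the base point. Hence every element has a normal form: its syllables are
  nontrivial, neighbouring ones come from different factors, and the first one does not come from
  \<open>As(Q\<^sub>i)\<close> (lemma \<open>nf_exists\<close>). It suffices to separate elements with different normal forms by
  homomorphisms to finite quandles, which by the universal property of the coproduct
  (\<open>free_product_hom_exists\<close>) amount to families of homomorphisms from the factors.

  If two normal forms have the same factor of the base point and the same syllables, then their base
  points differ. A finite image of \<open>Q\<^sub>i\<close> separates the base points; all other factors are sent to
  one of its points, and the common syllables act on it injectively
  (\<open>separate_base_points\<close>).

  Otherwise the syllables or the factors of the base points differ. Choose homomorphisms from the groups
  \<open>As(Q\<^sub>j)\<close> to finite groups \<open>P\<^sub>j\<close> that keep the finitely many syllables apart from each other and
  from the identity, with \<open>P\<^sub>j\<close> trivial where no syllable occurs. Then let the groups \<open>P\<^sub>j\<close> act, as in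
  van der Waerden's proof of the normal form theorem for free products of groups, on the reduced words
  of bounded length whose first letter is not from \<open>P\<^sub>i\<close>. There are finitely many such words. The
  empty word is fixed by \<open>P\<^sub>i\<close> and is moved by the syllables of a normal form to the word of their
  images. To turn this into a quandle, consider pairs of a permutation of the words and an optional
  word that it fixes; they form a finite quandle in which the permutations are conjugated and the
  words are moved. The factor \<open>Q\<^sub>i\<close> maps to pairs with the empty word, the other factors map
  to pairs without a word, and the image of an element now displays its syllables
  (\<open>separate_words\<close>).
\<close>

section \<open>Division and homomorphisms of quandles\<close>

context quandle
begin

lemma div_spec:
  assumes "x \<in> carrier Q" "y \<in> carrier Q"
  shows "quandle_div Q x y \<in> carrier Q \<and> x = quandle_div Q x y \<star> y"
  unfolding quandle_div_def by (rule theI'[OF qop_unique_div[OF assms]])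

lemma div_closed: "\<lbrakk>x \<in> carrier Q; y \<in> carrier Q\<rbrakk> \<Longrightarrow> quandle_div Q x y \<in> carrier Q"
  by (simp add: div_spec)

lemma div_op: "\<lbrakk>x \<in> carrier Q; y \<in> carrier Q\<rbrakk> \<Longrightarrow> quandle_div Q x y \<star> y = x"
  using div_spec by simp

lemma div_eqI:
  assumes "z \<in> carrier Q" "y \<in> carrier Q" "z \<star> y = x"
  shows "quandle_div Q x y = z"
proof -
  have x: "x \<in> carrier Q" using assms qop_closed by blast
  show ?thesis
    unfolding quandle_div_def using qop_unique_div[OF x assms(2)] assms by (intro the1_equality) auto
qed

lemma op_div: "\<lbrakk>x \<in> carrier Q; y \<in> carrier Q\<rbrakk> \<Longrightarrow> quandle_div Q (x \<star> y) y = x"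
  by (rule div_eqI) auto

lemma op_cancel: "\<lbrakk>x \<in> carrier Q; x' \<in> carrier Q; y \<in> carrier Q; x \<star> y = x' \<star> y\<rbrakk> \<Longrightarrow> x = x'"
  using op_div by metis

text \<open>
  Right translation by \<open>x \<star> y\<close> is conjugate to right translation by \<open>x\<close> under right translation
  by \<open>y\<close>, and likewise for division. Hence acting by a compound element reduces to acting by its
  parts.
\<close>

lemma op_op_right:
  assumes "s \<in> carrier Q" "x \<in> carrier Q" "y \<in> carrier Q"
  shows "s \<star> (x \<star> y) = (quandle_div Q s y \<star> x) \<star> y"
  using assms qop_distrib[of "quandle_div Q s y" x y] by (simp add: div_closed div_op)

lemma div_op_right:
  assumes "s \<in> carrier Q" "x \<in> carrier Q" "y \<in> carrier Q"
  shows "quandle_div Q s (x \<star> y) = quandle_div Q (quandle_div Q s y) x \<star> y"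
  using assms qop_distrib[of "quandle_div Q (quandle_div Q s y) x" x y]
  by (intro div_eqI) (simp_all add: div_closed div_op qop_closed)

lemma op_div_right:
  assumes "s \<in> carrier Q" "x \<in> carrier Q" "y \<in> carrier Q"
  shows "s \<star> quandle_div Q x y = quandle_div Q ((s \<star> y) \<star> x) y"
  using assms qop_distrib[of s "quandle_div Q x y" y]
  by (intro div_eqI[symmetric]) (simp_all add: div_closed div_op qop_closed)

lemma div_div_right:
  assumes "s \<in> carrier Q" "x \<in> carrier Q" "y \<in> carrier Q"
  shows "quandle_div Q s (quandle_div Q x y) = quandle_div Q (quandle_div Q (s \<star> y) x) y"
proof (rule div_eqI)
  let ?r = "quandle_div Q (quandle_div Q (s \<star> y) x) y" and ?z = "quandle_div Q x y"
  have c: "?r \<in> carrier Q" "?z \<in> carrier Q" "?r \<star> ?z \<in> carrier Q"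
    using assms by (simp_all add: div_closed qop_closed)
  have "(?r \<star> ?z) \<star> y = (?r \<star> y) \<star> (?z \<star> y)"
    using c assms by (intro qop_distrib)
  also have "\<dots> = s \<star> y"
    using assms by (simp add: div_closed div_op qop_closed)
  finally show "?r \<star> ?z = s"
    using op_cancel c assms by blast
qed (use assms in \<open>simp_all add: div_closed qop_closed\<close>)

end

lemma quandle_homD:
  assumes "f \<in> quandle_hom Q Q'"
  shows "x \<in> carrier Q \<Longrightarrow> f x \<in> carrier Q'"
    and "\<lbrakk>x \<in> carrier Q; y \<in> carrier Q\<rbrakk> \<Longrightarrow> f (x \<star>\<^bsub>Q\<^esub> y) = f x \<star>\<^bsub>Q'\<^esub> f y"
  using assms unfolding quandle_hom_def by auto

lemma quandle_homI:
  assumes "\<And>x. x \<in> carrier Q \<Longrightarrow> f x \<in> carrier Q'"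
    and "\<And>x y. \<lbrakk>x \<in> carrier Q; y \<in> carrier Q\<rbrakk> \<Longrightarrow> f (x \<star>\<^bsub>Q\<^esub> y) = f x \<star>\<^bsub>Q'\<^esub> f y"
  shows "f \<in> quandle_hom Q Q'"
  using assms unfolding quandle_hom_def by auto

lemma quandle_hom_div:
  assumes "quandle Q" "quandle Q'" "f \<in> quandle_hom Q Q'" "x \<in> carrier Q" "y \<in> carrier Q"
  shows "f (quandle_div Q x y) = quandle_div Q' (f x) (f y)"
proof (rule quandle.div_eqI[OF assms(2), symmetric])
  have d: "quandle_div Q x y \<in> carrier Q" "quandle_div Q x y \<star>\<^bsub>Q\<^esub> y = x"
    using quandle.div_closed[OF assms(1,4,5)] quandle.div_op[OF assms(1,4,5)] .
  show "f (quandle_div Q x y) \<star>\<^bsub>Q'\<^esub> f y = f x"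
    using quandle_homD(2)[OF assms(3) d(1) assms(5), symmetric] unfolding d(2) .
  show "f (quandle_div Q x y) \<in> carrier Q'" "f y \<in> carrier Q'"
    using quandle_homD(1)[OF assms(3)] d(1) assms(5) by simp_all
qed

lemma quandle_hom_compose:
  assumes "f \<in> quandle_hom Q Q'" "g \<in> quandle_hom Q' Q''"
  shows "g \<circ> f \<in> quandle_hom Q Q''"
  using assms unfolding quandle_hom_def by (auto simp: Pi_iff)

lemma quandle_hom_const:
  assumes "quandle Q'" "c \<in> carrier Q'"
  shows "(\<lambda>_. c) \<in> quandle_hom Q Q'"
  using assms by (auto intro: quandle_homI simp: quandle.qop_idem)

lemma quandle_iso_inv_into:
  assumes "f \<in> quandle_iso Q Q'" "quandle Q"
  shows "inv_into (carrier Q) f \<in> quandle_hom Q' Q"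
proof -
  have f: "f \<in> quandle_hom Q Q'" "inj_on f (carrier Q)" "f ` carrier Q = carrier Q'"
    using assms unfolding quandle_iso_def bij_betw_def by auto
  show ?thesis
  proof (rule quandle_homI)
    show "inv_into (carrier Q) f x \<in> carrier Q" if "x \<in> carrier Q'" for x
      using that f(3) by (metis inv_into_into)
    fix x y assume "x \<in> carrier Q'" "y \<in> carrier Q'"
    then obtain x0 y0 where xy: "x0 \<in> carrier Q" "y0 \<in> carrier Q" "x = f x0" "y = f y0"
      using f(3) by blast
    then have "x \<star>\<^bsub>Q'\<^esub> y = f (x0 \<star>\<^bsub>Q\<^esub> y0)" "x0 \<star>\<^bsub>Q\<^esub> y0 \<in> carrier Q"
      using quandle_homD(2)[OF f(1)] quandle.qop_closed[OF assms(2)] by simp_all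
    then show "inv_into (carrier Q) f (x \<star>\<^bsub>Q'\<^esub> y)
        = inv_into (carrier Q) f x \<star>\<^bsub>Q\<^esub> inv_into (carrier Q) f y"
      using xy f(2) by simp
  qed
qed

lemma finite_quandle_embeds_nat:
  fixes F :: "'b quandle"
  assumes F: "quandle F" "finite (carrier F)"
  obtains F' :: "nat quandle" and \<psi>
    where "quandle F'" "finite (carrier F')" "\<psi> \<in> quandle_hom F F'" "inj_on \<psi> (carrier F)"
proof -
  obtain \<psi> :: "'b \<Rightarrow> nat" where inj: "inj_on \<psi> (carrier F)"
    using finite_imp_inj_to_nat_seg[OF F(2)] by blast
  define \<psi>' where "\<psi>' = inv_into (carrier F) \<psi>"
  have inv: "\<psi>' (\<psi> x) = x" if "x \<in> carrier F" for x
    using that inj by (simp add: \<psi>'_def)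
  define F' :: "nat quandle" where
    "F' = \<lparr>carrier = \<psi> ` carrier F, qop = (\<lambda>m n. \<psi> (\<psi>' m \<star>\<^bsub>F\<^esub> \<psi>' n))\<rparr>"
  have car: "carrier F' = \<psi> ` carrier F"
    by (simp add: F'_def)
  have op: "\<psi> x \<star>\<^bsub>F'\<^esub> \<psi> y = \<psi> (x \<star>\<^bsub>F\<^esub> y)" if "x \<in> carrier F" "y \<in> carrier F" for x y
    using that by (simp add: F'_def inv)
  interpret F: quandle F by (rule F)
  have "quandle F'"
  proof
    show "carrier F' \<noteq> {}" using F.carrier_nonempty car by simp
    fix x y assume xy: "x \<in> carrier F'" "y \<in> carrier F'"
    then obtain a b where ab: "a \<in> carrier F" "b \<in> carrier F" "x = \<psi> a" "y = \<psi> b"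
      using car by auto
    show "x \<star>\<^bsub>F'\<^esub> y \<in> carrier F'" using ab op car F.qop_closed by simp
    show "x \<star>\<^bsub>F'\<^esub> x = x" using ab op F.qop_idem by simp
    show "\<exists>!z. z \<in> carrier F' \<and> x = z \<star>\<^bsub>F'\<^esub> y"
    proof (rule ex1I[where a = "\<psi> (quandle_div F a b)"])
      show "\<psi> (quandle_div F a b) \<in> carrier F' \<and> x = \<psi> (quandle_div F a b) \<star>\<^bsub>F'\<^esub> y"
        using ab op car by (simp add: F.div_closed F.div_op)
      fix z assume z: "z \<in> carrier F' \<and> x = z \<star>\<^bsub>F'\<^esub> y"
      then obtain c where c: "c \<in> carrier F" "z = \<psi> c" using car by auto
      then have "\<psi> a = \<psi> (c \<star>\<^bsub>F\<^esub> b)" using z ab op by simp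
      then have "a = c \<star>\<^bsub>F\<^esub> b"
        using inj ab c F.qop_closed[OF c(1) ab(2)] by (simp add: inj_on_eq_iff)
      then show "z = \<psi> (quandle_div F a b)" using c ab F.op_div by simp
    qed
    fix z assume "z \<in> carrier F'"
    then obtain c where c: "c \<in> carrier F" "z = \<psi> c" using car by auto
    show "(x \<star>\<^bsub>F'\<^esub> y) \<star>\<^bsub>F'\<^esub> z = (x \<star>\<^bsub>F'\<^esub> z) \<star>\<^bsub>F'\<^esub> (y \<star>\<^bsub>F'\<^esub> z)"
      using ab c F.qop_distrib[OF ab(1,2) c(1)] by (simp add: op F.qop_closed)
  qed
  moreover have "\<psi> \<in> quandle_hom F F'"
    using op car by (auto intro: quandle_homI)
  moreover have "finite (carrier F')" using car F(2) by simp
  ultimately show thesis using that inj by blast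
qed

text \<open>
  The separating quandles built below have carriers of words and permutations; this carries
  them over to the type in which residual finiteness quantifies over its targets.
\<close>

lemma separated_by_nat_quandle:
  fixes F :: "'b quandle"
  assumes F: "quandle F" "finite (carrier F)"
    and \<phi>: "\<phi> \<in> quandle_hom Q F" "\<phi> x \<noteq> \<phi> y" and xy: "x \<in> carrier Q" "y \<in> carrier Q"
  shows "\<exists>(F :: nat quandle) \<phi>. quandle F \<and> finite (carrier F) \<and> \<phi> \<in> quandle_hom Q F \<and> \<phi> x \<noteq> \<phi> y"
proof -
  obtain F' :: "nat quandle" and \<psi>
    where F': "quandle F'" "finite (carrier F')" "\<psi> \<in> quandle_hom F F'" "inj_on \<psi> (carrier F)"
    using finite_quandle_embeds_nat[OF F] .
  have "(\<psi> \<circ> \<phi>) x \<noteq> (\<psi> \<circ> \<phi>) y"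
    using \<phi>(2) F'(4) xy quandle_homD(1)[OF \<phi>(1)] by (auto dest: inj_onD)
  then show ?thesis
    using F' quandle_hom_compose[OF \<phi>(1) F'(3)] by blast
qed

section \<open>Quandles given by generators and relations\<close>

primrec qeval :: "('a, 'm) quandle_scheme \<Rightarrow> ('g \<Rightarrow> 'a) \<Rightarrow> 'g qterm \<Rightarrow> 'a" where
  "qeval F g (QGen x) = g x"
| "qeval F g (QOp s t) = qeval F g s \<star>\<^bsub>F\<^esub> qeval F g t"
| "qeval F g (QDiv s t) = quandle_div F (qeval F g s) (qeval F g t)"

lemma qterms_simps [simp]:
  "QGen x \<in> qterms X \<longleftrightarrow> x \<in> X"
  "QOp s t \<in> qterms X \<longleftrightarrow> s \<in> qterms X \<and> t \<in> qterms X"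
  "QDiv s t \<in> qterms X \<longleftrightarrow> s \<in> qterms X \<and> t \<in> qterms X"
  by (auto simp: qterms_def)

lemma qeval_closed:
  assumes "quandle F" "\<And>x. x \<in> X \<Longrightarrow> g x \<in> carrier F" "t \<in> qterms X"
  shows "qeval F g t \<in> carrier F"
  using assms(3)
  by (induction t) (auto intro: assms(2) quandle.qop_closed[OF assms(1)] quandle.div_closed[OF assms(1)])

lemma free_quandle_rel_qterms:
  "(s, t) \<in> free_quandle_rel X \<Longrightarrow> s \<in> qterms X \<and> t \<in> qterms X"
  by (induction rule: free_quandle_rel.induct) auto

lemma equiv_free_quandle_rel: "equiv (qterms X) (free_quandle_rel X)"
proof (rule equivI)
  show "refl_on (qterms X) (free_quandle_rel X)"
    by (auto simp: refl_on_def intro: fq_refl)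
  show "free_quandle_rel X \<subseteq> qterms X \<times> qterms X"
    using free_quandle_rel_qterms by auto
  show "sym (free_quandle_rel X)" by (auto simp: sym_def intro: fq_sym)
  show "trans (free_quandle_rel X)" by (auto simp: trans_def intro: fq_trans)
qed

text \<open>Each generating identity of the relation is a law of quandles, so every assignment respects it.\<close>

lemma free_quandle_rel_sound:
  assumes F: "quandle F" and g: "\<And>x. x \<in> X \<Longrightarrow> g x \<in> carrier F"
    and "(s, t) \<in> free_quandle_rel X"
  shows "qeval F g s = qeval F g t"
proof -
  interpret F: quandle F by (rule F)
  note [simp] = qeval_closed[OF F g]
  show ?thesis
    using assms(3)
    by (induction rule: free_quandle_rel.induct)
       (auto simp: F.qop_idem F.op_div F.div_op intro: F.qop_distrib)
qed

abbreviation free_class :: "'g set \<Rightarrow> 'g qterm \<Rightarrow> 'g qterm set" where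
  "free_class X t \<equiv> free_quandle_rel X `` {t}"

lemma free_class_eq_iff:
  "\<lbrakk>s \<in> qterms X; t \<in> qterms X\<rbrakk> \<Longrightarrow> free_class X s = free_class X t \<longleftrightarrow> (s, t) \<in> free_quandle_rel X"
  using eq_equiv_class_iff[OF equiv_free_quandle_rel] .

lemma carrier_free_quandle: "carrier (free_quandle X) = free_class X ` qterms X"
  by (auto simp: free_quandle_def quotient_def)

lemma free_quandle_op:
  assumes "s \<in> qterms X" "t \<in> qterms X"
  shows "free_class X s \<star>\<^bsub>free_quandle X\<^esub> free_class X t = free_class X (QOp s t)"
proof -
  have "congruent2 (free_quandle_rel X) (free_quandle_rel X) (\<lambda>s t. free_class X (QOp s t))"
    by (rule congruent2I') (intro equiv_class_eq[OF equiv_free_quandle_rel] fq_op)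
  from UN_equiv_class2[OF equiv_free_quandle_rel equiv_free_quandle_rel this assms]
  show ?thesis by (simp add: free_quandle_def)
qed

lemma quandle_free_quandle:
  assumes "X \<noteq> {}"
  shows "quandle (free_quandle X)"
proof
  show "carrier (free_quandle X) \<noteq> {}"
    using assms qterms_simps(1) unfolding carrier_free_quandle by (metis all_not_in_conv image_is_empty)
  fix A B assume "A \<in> carrier (free_quandle X)" "B \<in> carrier (free_quandle X)"
  then obtain a b where ab: "a \<in> qterms X" "b \<in> qterms X" "A = free_class X a" "B = free_class X b"
    unfolding carrier_free_quandle by blast
  show "A \<star>\<^bsub>free_quandle X\<^esub> B \<in> carrier (free_quandle X)"
    using ab by (simp add: free_quandle_op carrier_free_quandle)
  show "A \<star>\<^bsub>free_quandle X\<^esub> A = A"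
    using ab by (simp add: free_quandle_op free_class_eq_iff fq_idem)
  show "\<exists>!z. z \<in> carrier (free_quandle X) \<and> A = z \<star>\<^bsub>free_quandle X\<^esub> B"
  proof (rule ex1I[where a = "free_class X (QDiv a b)"])
    show "free_class X (QDiv a b) \<in> carrier (free_quandle X) \<and>
        A = free_class X (QDiv a b) \<star>\<^bsub>free_quandle X\<^esub> B"
      using ab by (simp add: free_quandle_op carrier_free_quandle free_class_eq_iff fq_op_div fq_sym)
    fix z assume z: "z \<in> carrier (free_quandle X) \<and> A = z \<star>\<^bsub>free_quandle X\<^esub> B"
    then obtain c where c: "c \<in> qterms X" "z = free_class X c"
      unfolding carrier_free_quandle by blast
    then have "(a, QOp c b) \<in> free_quandle_rel X"
      using z ab by (simp add: free_quandle_op free_class_eq_iff)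
    then have "(QDiv a b, QDiv (QOp c b) b) \<in> free_quandle_rel X"
      using ab by (intro fq_div fq_refl)
    then have "(QDiv a b, c) \<in> free_quandle_rel X"
      using fq_div_op c ab fq_trans by blast
    then show "z = free_class X (QDiv a b)"
      using ab c by (simp add: free_class_eq_iff fq_sym)
  qed
  fix C assume "C \<in> carrier (free_quandle X)"
  then obtain c where "c \<in> qterms X" "C = free_class X c"
    unfolding carrier_free_quandle by blast
  then show "(A \<star>\<^bsub>free_quandle X\<^esub> B) \<star>\<^bsub>free_quandle X\<^esub> C
      = (A \<star>\<^bsub>free_quandle X\<^esub> C) \<star>\<^bsub>free_quandle X\<^esub> (B \<star>\<^bsub>free_quandle X\<^esub> C)"
    using ab by (simp add: free_quandle_op free_class_eq_iff fq_distrib)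
qed

lemma free_quandle_div:
  assumes "s \<in> qterms X" "t \<in> qterms X"
  shows "quandle_div (free_quandle X) (free_class X s) (free_class X t) = free_class X (QDiv s t)"
proof -
  have "X \<noteq> {}"
    using assms(1) by (induction s) auto
  then show ?thesis
    using assms
    by (intro quandle.div_eqI quandle_free_quandle)
       (simp_all add: free_quandle_op carrier_free_quandle free_class_eq_iff fq_op_div)
qed

lemma quandle_congruence_generated:
  assumes Q: "quandle Q" and R: "R \<subseteq> carrier Q \<times> carrier Q"
  shows "quandle_congruence Q (generated_congruence Q R)"
    and "R \<subseteq> generated_congruence Q R"
proof -
  interpret quandle Q by (rule Q)
  let ?T = "{\<theta>. quandle_congruence Q \<theta> \<and> R \<subseteq> \<theta>}"
  have total: "carrier Q \<times> carrier Q \<in> ?T"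
    using R by (auto simp: quandle_congruence_def equiv_def refl_on_def sym_def trans_def qop_closed div_closed)
  have eq: "equiv (carrier Q) \<theta>" if "\<theta> \<in> ?T" for \<theta>
    using that by (simp add: quandle_congruence_def)
  have "equiv (carrier Q) (\<Inter>?T)"
  proof (rule equivI)
    show "\<Inter>?T \<subseteq> carrier Q \<times> carrier Q" using total by blast
    show "refl_on (carrier Q) (\<Inter>?T)"
      using eq by (fastforce simp: refl_on_def equiv_def)
    show "sym (\<Inter>?T)" using eq by (fastforce simp: sym_def equiv_def)
    show "trans (\<Inter>?T)"
    proof (rule transI)
      fix x y z assume *: "(x, y) \<in> \<Inter>?T" "(y, z) \<in> \<Inter>?T"
      show "(x, z) \<in> \<Inter>?T"
      proof
        fix \<theta> assume "\<theta> \<in> ?T"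
        then have "trans \<theta>" "(x, y) \<in> \<theta>" "(y, z) \<in> \<theta>"
          using eq * by (auto simp: equiv_def)
        then show "(x, z) \<in> \<theta>" by (rule transD)
      qed
    qed
  qed
  then show "quandle_congruence Q (generated_congruence Q R)"
    unfolding quandle_congruence_def generated_congruence_def by blast
  show "R \<subseteq> generated_congruence Q R"
    unfolding generated_congruence_def by blast
qed

lemma quotient_quandle_op:
  assumes "quandle_congruence Q \<theta>" "x \<in> carrier Q" "y \<in> carrier Q"
  shows "\<theta> `` {x} \<star>\<^bsub>quotient_quandle Q \<theta>\<^esub> \<theta> `` {y} = \<theta> `` {x \<star>\<^bsub>Q\<^esub> y}"
proof -
  have eq: "equiv (carrier Q) \<theta>"
    using assms by (simp add: quandle_congruence_def)
  have "congruent2 \<theta> \<theta> (\<lambda>x y. \<theta> `` {x \<star>\<^bsub>Q\<^esub> y})"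
    using assms(1) by (intro congruent2I' equiv_class_eq[OF eq]) (auto simp: quandle_congruence_def)
  from UN_equiv_class2[OF eq eq this assms(2,3)]
  show ?thesis by (simp add: quotient_quandle_def)
qed

lemma carrier_quotient_quandle:
  "carrier (quotient_quandle Q \<theta>) = (\<lambda>x. \<theta> `` {x}) ` carrier Q"
  by (auto simp: quotient_quandle_def quotient_def)

text \<open>
  Unique division in the quotient is where compatibility of the congruence with division is used:
  \<open>z \<star> y\<close> related to \<open>x\<close> yields \<open>z\<close> related to the quotient of \<open>x\<close> by \<open>y\<close>.
\<close>

lemma quandle_quotient_quandle:
  assumes Q: "quandle Q" and \<theta>: "quandle_congruence Q \<theta>"
  shows "quandle (quotient_quandle Q \<theta>)"
proof
  interpret quandle Q by (rule Q)
  have eq: "equiv (carrier Q) \<theta>"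
    using \<theta> by (simp add: quandle_congruence_def)
  note class_eq = eq_equiv_class_iff[OF eq]
  note op = quotient_quandle_op[OF \<theta>]
  note car = carrier_quotient_quandle[of Q \<theta>]
  let ?P = "quotient_quandle Q \<theta>"
  show "carrier ?P \<noteq> {}" using carrier_nonempty by (simp add: car)
  fix A B assume "A \<in> carrier ?P" "B \<in> carrier ?P"
  then obtain a b where ab: "a \<in> carrier Q" "b \<in> carrier Q" "A = \<theta> `` {a}" "B = \<theta> `` {b}"
    unfolding car by blast
  show "A \<star>\<^bsub>?P\<^esub> B \<in> carrier ?P" using ab by (simp add: op car qop_closed)
  show "A \<star>\<^bsub>?P\<^esub> A = A" using ab by (simp add: op qop_idem)
  show "\<exists>!z. z \<in> carrier ?P \<and> A = z \<star>\<^bsub>?P\<^esub> B"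
  proof (rule ex1I[where a = "\<theta> `` {quandle_div Q a b}"])
    show "\<theta> `` {quandle_div Q a b} \<in> carrier ?P \<and> A = \<theta> `` {quandle_div Q a b} \<star>\<^bsub>?P\<^esub> B"
      using ab by (simp add: op car div_closed div_op)
    fix z assume z: "z \<in> carrier ?P \<and> A = z \<star>\<^bsub>?P\<^esub> B"
    then obtain c where c: "c \<in> carrier Q" "z = \<theta> `` {c}"
      unfolding car by blast
    then have "(c \<star>\<^bsub>Q\<^esub> b, a) \<in> \<theta>"
      using z ab by (metis class_eq op qop_closed)
    moreover have "(b, b) \<in> \<theta>"
      using ab class_eq by blast
    ultimately have "(quandle_div Q (c \<star>\<^bsub>Q\<^esub> b) b, quandle_div Q a b) \<in> \<theta>"
      using \<theta> unfolding quandle_congruence_def by blast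
    then show "z = \<theta> `` {quandle_div Q a b}"
      using c ab by (simp add: op_div class_eq div_closed)
  qed
  fix C assume "C \<in> carrier ?P"
  then obtain c where c: "c \<in> carrier Q" "C = \<theta> `` {c}"
    unfolding car by blast
  show "(A \<star>\<^bsub>?P\<^esub> B) \<star>\<^bsub>?P\<^esub> C = (A \<star>\<^bsub>?P\<^esub> C) \<star>\<^bsub>?P\<^esub> (B \<star>\<^bsub>?P\<^esub> C)"
    using ab c qop_distrib[OF ab(1,2) c(1)] by (simp add: op qop_closed)
qed

locale quandle_pres =
  fixes X :: "'g set" and R :: "('g qterm \<times> 'g qterm) set"
  assumes gens_nonempty: "X \<noteq> {}" and rels: "R \<subseteq> qterms X \<times> qterms X"
begin

definition \<theta> where
  "\<theta> = generated_congruence (free_quandle X) {(free_class X s, free_class X t) | s t. (s, t) \<in> R}"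

definition cls :: "'g qterm \<Rightarrow> 'g qterm set set" where
  "cls t = \<theta> `` {free_class X t}"

lemma presented_eq: "presented_quandle X R = quotient_quandle (free_quandle X) \<theta>"
  by (simp add: presented_quandle_def \<theta>_def)

lemma \<theta>: "quandle_congruence (free_quandle X) \<theta>"
  and rel_\<theta>: "{(free_class X s, free_class X t) | s t. (s, t) \<in> R} \<subseteq> \<theta>"
  unfolding \<theta>_def using rels
  by (intro quandle_congruence_generated quandle_free_quandle gens_nonempty;
      auto simp: carrier_free_quandle)+

lemma quandle_presented: "quandle (presented_quandle X R)"
  unfolding presented_eq by (intro quandle_quotient_quandle quandle_free_quandle gens_nonempty \<theta>)

lemma carrier_presented: "carrier (presented_quandle X R) = cls ` qterms X"
  by (auto simp: presented_eq carrier_quotient_quandle carrier_free_quandle cls_def)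

lemma cls_closed: "t \<in> qterms X \<Longrightarrow> cls t \<in> carrier (presented_quandle X R)"
  by (simp add: carrier_presented)

lemma cls_op:
  "\<lbrakk>s \<in> qterms X; t \<in> qterms X\<rbrakk> \<Longrightarrow> cls (QOp s t) = cls s \<star>\<^bsub>presented_quandle X R\<^esub> cls t"
  using quotient_quandle_op[OF \<theta>, of "free_class X s" "free_class X t"]
  by (simp add: presented_eq cls_def carrier_free_quandle free_quandle_op)

lemma cls_div:
  assumes "s \<in> qterms X" "t \<in> qterms X"
  shows "cls (QDiv s t) = quandle_div (presented_quandle X R) (cls s) (cls t)"
proof (rule quandle.div_eqI[OF quandle_presented, symmetric])
  have "free_class X (QOp (QDiv s t) t) = free_class X s"
    using assms by (simp add: free_class_eq_iff fq_op_div)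
  then have "cls (QOp (QDiv s t) t) = cls s"
    by (simp add: cls_def)
  then show "cls (QDiv s t) \<star>\<^bsub>presented_quandle X R\<^esub> cls t = cls s"
    using assms cls_op[of "QDiv s t" t] by simp
qed (use assms in \<open>simp_all add: cls_closed\<close>)

lemma cls_rel:
  assumes "(s, t) \<in> R"
  shows "cls s = cls t"
proof -
  have "equiv (carrier (free_quandle X)) \<theta>"
    using \<theta> by (simp add: quandle_congruence_def)
  moreover have "(free_class X s, free_class X t) \<in> \<theta>"
    using rel_\<theta> assms by blast
  ultimately show ?thesis
    unfolding cls_def by (rule equiv_class_eq)
qed

lemma qeval_cls: "t \<in> qterms X \<Longrightarrow> qeval (presented_quandle X R) (\<lambda>x. cls (QGen x)) t = cls t"
  by (induction t) (simp_all add: cls_op cls_div)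

text \<open>
  The pairs of classes whose terms agree under an assignment satisfying the relations form a
  congruence of the free quandle that contains the relations. The congruence generated by the
  relations is the least one, hence lies below it. This is the universal property of the
  presentation.
\<close>

lemma cls_eq_imp_qeval_eq:
  assumes F: "quandle F" and g: "\<And>x. x \<in> X \<Longrightarrow> g x \<in> carrier F"
    and R: "\<And>s t. (s, t) \<in> R \<Longrightarrow> qeval F g s = qeval F g t"
    and st: "s \<in> qterms X" "t \<in> qterms X" "cls s = cls t"
  shows "qeval F g s = qeval F g t"
proof -
  define K where "K = {(free_class X s, free_class X t) | s t.
      s \<in> qterms X \<and> t \<in> qterms X \<and> qeval F g s = qeval F g t}"
  have sound: "qeval F g s = qeval F g t"
    if "s \<in> qterms X" "t \<in> qterms X" "free_class X s = free_class X t" for s t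
    using that free_quandle_rel_sound[OF F g] by (simp add: free_class_eq_iff)
  have K: "(free_class X s, free_class X t) \<in> K \<longleftrightarrow> qeval F g s = qeval F g t"
    if st: "s \<in> qterms X" "t \<in> qterms X" for s t
  proof
    assume "(free_class X s, free_class X t) \<in> K"
    then obtain s' t' where s't': "s' \<in> qterms X" "t' \<in> qterms X" "qeval F g s' = qeval F g t'"
      "free_class X s = free_class X s'" "free_class X t = free_class X t'"
      unfolding K_def by blast
    then show "qeval F g s = qeval F g t"
      using st sound[of s s'] sound[of t t'] by simp
  next
    assume "qeval F g s = qeval F g t"
    then show "(free_class X s, free_class X t) \<in> K"
      using st unfolding K_def by blast
  qed
  have K_cases: "\<exists>s t. s \<in> qterms X \<and> t \<in> qterms X \<and> qeval F g s = qeval F g t \<and>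
      p = (free_class X s, free_class X t)" if "p \<in> K" for p
    using that unfolding K_def by blast
  have "equiv (carrier (free_quandle X)) K"
  proof (rule equivI)
    show "K \<subseteq> carrier (free_quandle X) \<times> carrier (free_quandle X)"
      unfolding K_def carrier_free_quandle by blast
    show "refl_on (carrier (free_quandle X)) K"
      unfolding carrier_free_quandle by (auto simp: refl_on_def K)
    show "sym K"
    proof (rule symI)
      fix A B assume "(A, B) \<in> K"
      then obtain a b where "a \<in> qterms X" "b \<in> qterms X" "qeval F g a = qeval F g b"
        "A = free_class X a" "B = free_class X b"
        using K_cases by blast
      then show "(B, A) \<in> K" by (simp add: K)
    qed
    show "trans K"
    proof (rule transI)
      fix A B C assume "(A, B) \<in> K" "(B, C) \<in> K"
      moreover from this obtain a b where "a \<in> qterms X" "b \<in> qterms X" "qeval F g a = qeval F g b"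
        "A = free_class X a" "B = free_class X b"
        using K_cases by blast
      moreover from calculation obtain b' c where "b' \<in> qterms X" "c \<in> qterms X"
        "qeval F g b' = qeval F g c" "B = free_class X b'" "C = free_class X c"
        using K_cases by blast
      ultimately show "(A, C) \<in> K"
        using K[of a c] sound[of b b'] by simp
    qed
  qed
  moreover have "(A \<star>\<^bsub>free_quandle X\<^esub> B, A' \<star>\<^bsub>free_quandle X\<^esub> B') \<in> K \<and>
      (quandle_div (free_quandle X) A B, quandle_div (free_quandle X) A' B') \<in> K"
    if AB: "(A, A') \<in> K" "(B, B') \<in> K" for A A' B B'
  proof -
    obtain a a' where a: "a \<in> qterms X" "a' \<in> qterms X" "qeval F g a = qeval F g a'"
      "A = free_class X a" "A' = free_class X a'"
      using K_cases[OF AB(1)] by blast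
    obtain b b' where b: "b \<in> qterms X" "b' \<in> qterms X" "qeval F g b = qeval F g b'"
      "B = free_class X b" "B' = free_class X b'"
      using K_cases[OF AB(2)] by blast
    show ?thesis
      using a b by (simp add: free_quandle_op free_quandle_div K)
  qed
  ultimately have "quandle_congruence (free_quandle X) K"
    unfolding quandle_congruence_def by blast
  moreover have "{(free_class X s, free_class X t) | s t. (s, t) \<in> R} \<subseteq> K"
    using K R rels by blast
  ultimately have "\<theta> \<subseteq> K"
    unfolding \<theta>_def generated_congruence_def by blast
  moreover have "(free_class X s, free_class X t) \<in> \<theta>"
    using st \<theta> eq_equiv_class_iff[of "carrier (free_quandle X)" \<theta>]
    by (simp add: cls_def quandle_congruence_def carrier_free_quandle)
  ultimately show ?thesis using K st by blast
qed

lemma presented_hom_exists: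
  assumes F: "quandle F" and g: "\<And>x. x \<in> X \<Longrightarrow> g x \<in> carrier F"
    and R: "\<And>s t. (s, t) \<in> R \<Longrightarrow> qeval F g s = qeval F g t"
  obtains \<Phi> where "\<Phi> \<in> quandle_hom (presented_quandle X R) F"
    and "\<And>t. t \<in> qterms X \<Longrightarrow> \<Phi> (cls t) = qeval F g t"
proof
  define \<Phi> where "\<Phi> A = qeval F g (SOME t. t \<in> qterms X \<and> A = cls t)" for A
  show *: "\<Phi> (cls t) = qeval F g t" if "t \<in> qterms X" for t
  proof -
    have "(SOME t'. t' \<in> qterms X \<and> cls t = cls t') \<in> qterms X \<and>
        cls t = cls (SOME t'. t' \<in> qterms X \<and> cls t = cls t')"
      by (rule someI[of _ t]) (simp add: that)
    then show ?thesis
      unfolding \<Phi>_def using cls_eq_imp_qeval_eq[OF F g R] that by metis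
  qed
  show "\<Phi> \<in> quandle_hom (presented_quandle X R) F"
  proof (rule quandle_homI)
    fix A B assume "A \<in> carrier (presented_quandle X R)" "B \<in> carrier (presented_quandle X R)"
    then obtain a b where ab: "a \<in> qterms X" "b \<in> qterms X" "A = cls a" "B = cls b"
      unfolding carrier_presented by blast
    show "\<Phi> A \<in> carrier F"
      using ab by (simp add: * qeval_closed[OF F g])
    show "\<Phi> (A \<star>\<^bsub>presented_quandle X R\<^esub> B) = \<Phi> A \<star>\<^bsub>F\<^esub> \<Phi> B"
      using ab *[of "QOp a b"] by (simp add: * cls_op)
  qed
qed

text \<open>
  A compound element acts as a composite of translations by its parts and their inverses. By
  induction on terms, a property preserved when generators act is preserved when any element acts,
  so every element is reached from a generator by acting with generators only.
\<close>

lemma presented_induct [consumes 1, case_names gen op div]: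
  assumes "A \<in> carrier (presented_quandle X R)"
    and gen: "\<And>x. x \<in> X \<Longrightarrow> P (cls (QGen x))"
    and op: "\<And>A x. \<lbrakk>A \<in> carrier (presented_quandle X R); P A; x \<in> X\<rbrakk>
      \<Longrightarrow> P (A \<star>\<^bsub>presented_quandle X R\<^esub> cls (QGen x))"
    and div: "\<And>A x. \<lbrakk>A \<in> carrier (presented_quandle X R); P A; x \<in> X\<rbrakk>
      \<Longrightarrow> P (quandle_div (presented_quandle X R) A (cls (QGen x)))"
  shows "P A"
proof -
  let ?F = "presented_quandle X R"
  interpret F: quandle ?F by (rule quandle_presented)
  have step: "\<forall>A \<in> carrier ?F. P A \<longrightarrow> P (A \<star>\<^bsub>?F\<^esub> cls t) \<and> P (quandle_div ?F A (cls t))"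
    if "t \<in> qterms X" for t
    using that
  proof (induction t)
    case (QGen x)
    then show ?case using op div by simp
  next
    case (QOp s t)
    then show ?case
      by (simp add: cls_op F.op_op_right F.div_op_right F.qop_closed F.div_closed cls_closed)
  next
    case (QDiv s t)
    then show ?case
      by (simp add: cls_div F.op_div_right F.div_div_right F.qop_closed F.div_closed cls_closed)
  qed
  have "P (cls t)" if "t \<in> qterms X" for t
    using that by (induction t) (use gen step in \<open>simp_all add: cls_op cls_div cls_closed\<close>)
  moreover obtain t where "t \<in> qterms X" "A = cls t"
    using assms(1) unfolding carrier_presented by blast
  ultimately show ?thesis by simp
qed

end

section \<open>The action of the associated group\<close>

abbreviation as_rel :: "('a, 'm) quandle_scheme \<Rightarrow> ((bool \<times> 'a) list \<times> (bool \<times> 'a) list) set" where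
  "as_rel Q \<equiv> group_word_rel (carrier Q)
     {([(True, x \<star>\<^bsub>Q\<^esub> y)], [(False, y), (True, x), (True, y)]) | x y.
        x \<in> carrier Q \<and> y \<in> carrier Q}"

abbreviation as_class :: "('a, 'm) quandle_scheme \<Rightarrow> (bool \<times> 'a) list \<Rightarrow> (bool \<times> 'a) list set" where
  "as_class Q w \<equiv> as_rel Q `` {w}"

lemma group_words_simps [simp]:
  "[] \<in> group_words S"
  "(b, x) # w \<in> group_words S \<longleftrightarrow> x \<in> S \<and> w \<in> group_words S"
  "u @ v \<in> group_words S \<longleftrightarrow> u \<in> group_words S \<and> v \<in> group_words S"
  by (auto simp: group_words_def)

lemma group_word_rel_words:
  "(u, v) \<in> group_word_rel S R \<Longrightarrow> u \<in> group_words S \<and> v \<in> group_words S"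
  by (induction rule: group_word_rel.induct) auto

lemma equiv_group_word_rel: "equiv (group_words S) (group_word_rel S R)"
proof (rule equivI)
  show "refl_on (group_words S) (group_word_rel S R)"
    by (auto simp: refl_on_def intro: gw_refl)
  show "group_word_rel S R \<subseteq> group_words S \<times> group_words S"
    using group_word_rel_words by auto
  show "sym (group_word_rel S R)" by (auto simp: sym_def intro: gw_sym)
  show "trans (group_word_rel S R)" by (auto simp: trans_def intro: gw_trans)
qed

lemma as_class_eq_iff:
  "\<lbrakk>u \<in> group_words (carrier Q); v \<in> group_words (carrier Q)\<rbrakk>
    \<Longrightarrow> as_class Q u = as_class Q v \<longleftrightarrow> (u, v) \<in> as_rel Q"
  using eq_equiv_class_iff[OF equiv_group_word_rel] .

lemma carrier_associated_group:
  "carrier (associated_group Q) = as_class Q ` group_words (carrier Q)"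
  by (auto simp: associated_group_def presented_group_def quotient_def)

lemma one_associated_group: "\<one>\<^bsub>associated_group Q\<^esub> = as_class Q []"
  by (simp add: associated_group_def presented_group_def)

lemma mult_associated_group:
  assumes "u \<in> group_words (carrier Q)" "v \<in> group_words (carrier Q)"
  shows "as_class Q u \<otimes>\<^bsub>associated_group Q\<^esub> as_class Q v = as_class Q (u @ v)"
proof -
  have "congruent2 (as_rel Q) (as_rel Q) (\<lambda>u v. as_class Q (u @ v))"
  proof (rule congruent2I')
    fix u u' v v' assume "(u, u') \<in> as_rel Q" "(v, v') \<in> as_rel Q"
    then show "as_class Q (u @ v) = as_class Q (u' @ v')"
      by (intro equiv_class_eq[OF equiv_group_word_rel] gw_append)
  qed
  from UN_equiv_class2[OF equiv_group_word_rel equiv_group_word_rel this assms]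
  show ?thesis by (simp add: associated_group_def presented_group_def)
qed

abbreviation as_gen :: "('a, 'm) quandle_scheme \<Rightarrow> 'a \<Rightarrow> (bool \<times> 'a) list set" where
  "as_gen Q x \<equiv> as_class Q [(True, x)]"

lemma as_gen_closed: "x \<in> carrier Q \<Longrightarrow> as_gen Q x \<in> carrier (associated_group Q)"
  by (simp add: carrier_associated_group)

lemma inv_as_gen:
  assumes "group (associated_group Q)" "x \<in> carrier Q"
  shows "inv\<^bsub>associated_group Q\<^esub> (as_gen Q x) = as_class Q [(False, x)]"
proof (rule group.inv_equality[OF assms(1)])
  show "as_class Q [(False, x)] \<otimes>\<^bsub>associated_group Q\<^esub> as_gen Q x = \<one>\<^bsub>associated_group Q\<^esub>"
    using assms(2) gw_cancel[of x "carrier Q" False]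
    by (simp add: mult_associated_group one_associated_group as_class_eq_iff)
qed (use assms(2) in \<open>simp_all add: carrier_associated_group\<close>)

lemma as_gen_op:
  assumes "group (associated_group Q)" "quandle Q" "x \<in> carrier Q" "y \<in> carrier Q"
  shows "as_gen Q (x \<star>\<^bsub>Q\<^esub> y) = inv\<^bsub>associated_group Q\<^esub> (as_gen Q y) \<otimes>\<^bsub>associated_group Q\<^esub>
    as_gen Q x \<otimes>\<^bsub>associated_group Q\<^esub> as_gen Q y"
proof -
  have "x \<star>\<^bsub>Q\<^esub> y \<in> carrier Q"
    using assms quandle.qop_closed by metis
  then have "([(True, x \<star>\<^bsub>Q\<^esub> y)], [(False, y), (True, x), (True, y)]) \<in> as_rel Q"
    using assms by (intro gw_relator) auto
  then show ?thesis
    using assms \<open>x \<star>\<^bsub>Q\<^esub> y \<in> carrier Q\<close>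
    by (simp add: inv_as_gen mult_associated_group as_class_eq_iff)
qed

primrec word_act :: "('b, 'n) quandle_scheme \<Rightarrow> ('a \<Rightarrow> 'b) \<Rightarrow> (bool \<times> 'a) list \<Rightarrow> 'b \<Rightarrow> 'b" where
  "word_act F f [] s = s"
| "word_act F f (l # w) s = word_act F f w
     (if fst l then s \<star>\<^bsub>F\<^esub> f (snd l) else quandle_div F s (f (snd l)))"

lemma word_act_append: "word_act F f (u @ v) s = word_act F f v (word_act F f u s)"
  by (induction u arbitrary: s) auto

lemma word_act_closed:
  assumes "quandle F" "f \<in> quandle_hom Q F" "w \<in> group_words (carrier Q)" "s \<in> carrier F"
  shows "word_act F f w s \<in> carrier F"
  using assms(3,4)
proof (induction w arbitrary: s)
  case (Cons l w)
  then show ?case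
    using quandle.qop_closed[OF assms(1)] quandle.div_closed[OF assms(1)] quandle_homD(1)[OF assms(2)]
    by (cases l) auto
qed auto

text \<open>
  The associated group acts on every quandle that receives a homomorphism from \<open>Q\<close>: its defining
  relation says that a translation by \<open>x \<star> y\<close> is a conjugate of the translation by \<open>x\<close>, which
  is self-distributivity.
\<close>

lemma word_act_cong:
  assumes F: "quandle F" and f: "f \<in> quandle_hom Q F"
    and "(u, v) \<in> as_rel Q" "s \<in> carrier F"
  shows "word_act F f u s = word_act F f v s"
  using assms(3,4)
proof (induction arbitrary: s rule: group_word_rel.induct)
  case (gw_append u u' v v')
  have "word_act F f u' s \<in> carrier F"
    using word_act_closed[OF F f] group_word_rel_words[OF gw_append.hyps(1)] gw_append.prems by blast
  then show ?case
    using gw_append by (simp add: word_act_append)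
next
  case (gw_cancel x b)
  then show ?case
    using quandle.op_div[OF F] quandle.div_op[OF F] quandle_homD(1)[OF f] by simp
next
  case (gw_relator u v)
  then obtain x y where xy: "x \<in> carrier Q" "y \<in> carrier Q"
    "u = [(True, x \<star>\<^bsub>Q\<^esub> y)]" "v = [(False, y), (True, x), (True, y)]"
    by blast
  then show ?case
    using gw_relator.prems quandle.op_op_right[OF F] by (simp add: quandle_homD[OF f])
qed auto

text \<open>By the preceding lemma the choice of a representative of the class \<open>a\<close> does not matter on \<open>F\<close>.\<close>

definition as_act :: "('b, 'n) quandle_scheme \<Rightarrow> ('a \<Rightarrow> 'b) \<Rightarrow> (bool \<times> 'a) list set \<Rightarrow> 'b \<Rightarrow> 'b" where
  "as_act F f a s = word_act F f (SOME w. w \<in> a) s"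

lemma as_act_class:
  assumes "quandle F" "f \<in> quandle_hom Q F" "w \<in> group_words (carrier Q)" "s \<in> carrier F"
  shows "as_act F f (as_class Q w) s = word_act F f w s"
proof -
  have "w \<in> as_class Q w"
    using assms(3) by (simp add: gw_refl)
  then have "(SOME v. v \<in> as_class Q w) \<in> as_class Q w"
    by (rule someI)
  then have "(w, SOME v. v \<in> as_class Q w) \<in> as_rel Q"
    by simp
  then show ?thesis
    unfolding as_act_def by (rule word_act_cong[OF assms(1,2) _ assms(4), symmetric])
qed

lemma as_act_closed:
  assumes "quandle F" "f \<in> quandle_hom Q F" "a \<in> carrier (associated_group Q)" "s \<in> carrier F"
  shows "as_act F f a s \<in> carrier F"
  using assms(3) unfolding carrier_associated_group
  by (auto simp: as_act_class[OF assms(1,2) _ assms(4)] word_act_closed[OF assms(1,2) _ assms(4)])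

lemma as_act_one:
  assumes "quandle F" "f \<in> quandle_hom Q F" "s \<in> carrier F"
  shows "as_act F f \<one>\<^bsub>associated_group Q\<^esub> s = s"
  using assms by (simp add: one_associated_group as_act_class)

lemma as_act_mult:
  assumes "quandle F" "f \<in> quandle_hom Q F"
    and "a \<in> carrier (associated_group Q)" "b \<in> carrier (associated_group Q)" "s \<in> carrier F"
  shows "as_act F f (a \<otimes>\<^bsub>associated_group Q\<^esub> b) s = as_act F f b (as_act F f a s)"
proof -
  obtain u v where uv: "u \<in> group_words (carrier Q)" "v \<in> group_words (carrier Q)"
    "a = as_class Q u" "b = as_class Q v"
    using assms unfolding carrier_associated_group by blast
  then have "word_act F f u s \<in> carrier F"
    using word_act_closed[OF assms(1,2)] assms(5) by blast
  then show ?thesis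
    using uv assms(5) by (simp add: mult_associated_group as_act_class[OF assms(1,2)] word_act_append)
qed

lemma as_act_gen:
  assumes "quandle F" "f \<in> quandle_hom Q F" "x \<in> carrier Q" "s \<in> carrier F"
  shows "as_act F f (as_gen Q x) s = s \<star>\<^bsub>F\<^esub> f x"
    and "as_act F f (as_class Q [(False, x)]) s = quandle_div F s (f x)"
  using assms by (simp_all add: as_act_class)

lemma as_act_inj:
  assumes Q: "group (associated_group Q)" and F: "quandle F" and f: "f \<in> quandle_hom Q F"
    and a: "a \<in> carrier (associated_group Q)" and st: "s \<in> carrier F" "t \<in> carrier F"
    and eq: "as_act F f a s = as_act F f a t"
  shows "s = t"
proof -
  interpret group "associated_group Q" by (rule Q)
  have "as_act F f (inv\<^bsub>associated_group Q\<^esub> a) (as_act F f a r) = r" if "r \<in> carrier F" for r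
    using as_act_mult[OF F f a inv_closed[OF a] that] as_act_one[OF F f that] a by simp
  then show ?thesis using st eq by metis
qed

text \<open>
  Homomorphisms commute with right translations and with division, hence with the action of every
  word. Thus the image of a translate can be computed in the target alone.
\<close>

lemma as_act_natural:
  assumes F: "quandle F" and f: "f \<in> quandle_hom Q F" and F': "quandle F'"
    and \<Phi>: "\<Phi> \<in> quandle_hom F F'" and a: "a \<in> carrier (associated_group Q)" and s: "s \<in> carrier F"
    and f': "f' \<in> quandle_hom Q F'" and eq: "\<And>x. x \<in> carrier Q \<Longrightarrow> f' x = \<Phi> (f x)"
  shows "\<Phi> (as_act F f a s) = as_act F' f' a (\<Phi> s)"
proof -
  have "\<Phi> (word_act F f w s) = word_act F' f' w (\<Phi> s)" if "w \<in> group_words (carrier Q)" for w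
    using that s
  proof (induction w arbitrary: s)
    case (Cons l w)
    obtain b x where l: "l = (b, x)" by fastforce
    have x: "x \<in> carrier Q" "f x \<in> carrier F" and w: "w \<in> group_words (carrier Q)"
      using Cons.prems l quandle_homD(1)[OF f] by auto
    have *: "\<Phi> (word_act F f w r) = word_act F' f' w (\<Phi> r)" if "r \<in> carrier F" for r
      using Cons.IH[OF w that] .
    show ?case
      using Cons.prems(2) x l quandle.qop_closed[OF F] quandle.div_closed[OF F]
      by (simp add: * eq quandle_homD(2)[OF \<Phi>] quandle_hom_div[OF F F' \<Phi>])
  qed simp
  then show ?thesis
    using a s quandle_homD(1)[OF \<Phi> s] unfolding carrier_associated_group
    by (auto simp: as_act_class[OF F f] as_act_class[OF F' f'])
qed

section \<open>Reduced words over a family of groups\<close>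

text \<open>
  Lists are read from right to left: the head is the last letter of a word, so that multiplication
  on the right happens at the head. The index \<open>i\<close> counts as the index of the empty word. A reduced
  word therefore never begins with a letter from \<open>P i\<close>, and reduced words represent the cosets of
  \<open>P i\<close> in the free product of the groups.
\<close>

fun last_index :: "'i \<Rightarrow> ('i \<times> 'p) list \<Rightarrow> 'i" where
  "last_index i [] = i"
| "last_index i ((j, p) # w) = j"

fun reduced :: "'i set \<Rightarrow> ('i \<Rightarrow> ('p, 'm) monoid_scheme) \<Rightarrow> 'i \<Rightarrow> ('i \<times> 'p) list \<Rightarrow> bool" where
  "reduced I P i [] \<longleftrightarrow> True"
| "reduced I P i ((j, p) # w) \<longleftrightarrow> j \<in> I \<and> p \<in> carrier (P j) \<and> p \<noteq> \<one>\<^bsub>P j\<^esub> \<and>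
     j \<noteq> last_index i w \<and> reduced I P i w"

text \<open>
  Van der Waerden's action of a free product on its reduced words, truncated at length \<open>N\<close>: a letter
  that would make the word too long is ignored. The empty word is a fixed point of \<open>P i\<close>, since it
  stands for the coset \<open>P i\<close> itself.
\<close>

definition append_letter ::
    "('i \<Rightarrow> ('p, 'm) monoid_scheme) \<Rightarrow> nat \<Rightarrow> 'i \<Rightarrow> 'p \<Rightarrow> ('i \<times> 'p) list \<Rightarrow> ('i \<times> 'p) list" where
  "append_letter P N j q w =
     (if q = \<one>\<^bsub>P j\<^esub> \<or> N \<le> length w then w else (j, q) # w)"

definition truncated_act ::
    "('i \<Rightarrow> ('p, 'm) monoid_scheme) \<Rightarrow> 'i \<Rightarrow> nat \<Rightarrow> 'i \<Rightarrow> 'p \<Rightarrow> ('i \<times> 'p) list \<Rightarrow> ('i \<times> 'p) list" where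
  "truncated_act P i N j q w =
     (if j \<noteq> last_index i w then append_letter P N j q w
      else case w of [] \<Rightarrow> [] | (k, p) # v \<Rightarrow> append_letter P N j (p \<otimes>\<^bsub>P j\<^esub> q) v)"

lemma truncated_act_Nil: "truncated_act P i N i q [] = []"
  by (simp add: truncated_act_def)

definition truncated_words ::
    "'i set \<Rightarrow> ('i \<Rightarrow> ('p, 'm) monoid_scheme) \<Rightarrow> 'i \<Rightarrow> nat \<Rightarrow> ('i \<times> 'p) list set" where
  "truncated_words I P i N = {w. reduced I P i w \<and> length w \<le> N}"

lemma truncated_words_cases:
  assumes "w \<in> truncated_words I P i N"
  obtains (extend) "j \<noteq> last_index i w"
  | (Nil) "j = i" "w = []"
  | (merge) p v where "w = (j, p) # v" "p \<in> carrier (P j)" "p \<noteq> \<one>\<^bsub>P j\<^esub>" "j \<noteq> last_index i v"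
      "v \<in> truncated_words I P i N" "length v < N" "j \<in> I"
proof (cases "j = last_index i w")
  case True
  with assms that(2,3) show thesis
    by (cases w; cases "hd w") (auto simp: truncated_words_def)
qed (rule that(1))

lemma append_letter_closed:
  assumes "w \<in> truncated_words I P i N" "j \<in> I" "q \<in> carrier (P j)" "j \<noteq> last_index i w"
  shows "append_letter P N j q w \<in> truncated_words I P i N"
  using assms by (auto simp: append_letter_def truncated_words_def)

lemma truncated_act_closed:
  assumes "group (P j)" "w \<in> truncated_words I P i N" "j \<in> I" "q \<in> carrier (P j)"
  shows "truncated_act P i N j q w \<in> truncated_words I P i N"
proof -
  interpret group "P j" by (rule assms)
  show ?thesis
    using assms(2)
  proof (cases rule: truncated_words_cases[where j = j])
    case extend
    then show ?thesis using assms append_letter_closed by (simp add: truncated_act_def)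
  next
    case Nil
    then show ?thesis using assms by (simp add: truncated_act_Nil)
  next
    case (merge p v)
    then have "append_letter P N j (p \<otimes>\<^bsub>P j\<^esub> q) v \<in> truncated_words I P i N"
      using assms by (intro append_letter_closed) auto
    then show ?thesis using merge by (simp add: truncated_act_def)
  qed
qed

lemma truncated_act_one:
  assumes "group (P j)" "w \<in> truncated_words I P i N"
  shows "truncated_act P i N j \<one>\<^bsub>P j\<^esub> w = w"
proof -
  interpret group "P j" by (rule assms)
  show ?thesis
    using assms(2)
    by (cases rule: truncated_words_cases[where j = j])
       (auto simp: truncated_act_def append_letter_def)
qed

text \<open>
  A word that \<open>j\<close> can extend and its one-letter extensions by \<open>j\<close> form a copy of \<open>P j\<close>, on which
  \<open>P j\<close> acts by right multiplication; at full length the word is fixed instead.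
\<close>

lemma truncated_act_append_letter:
  assumes "group (P j)" "p \<in> carrier (P j)" "q \<in> carrier (P j)" "j \<noteq> last_index i w"
  shows "truncated_act P i N j q (append_letter P N j p w) = append_letter P N j (p \<otimes>\<^bsub>P j\<^esub> q) w"
proof -
  interpret group "P j" by (rule assms)
  show ?thesis using assms by (auto simp: truncated_act_def append_letter_def)
qed

lemma truncated_act_mult:
  assumes "group (P j)" "w \<in> truncated_words I P i N" "q \<in> carrier (P j)" "r \<in> carrier (P j)"
  shows "truncated_act P i N j (q \<otimes>\<^bsub>P j\<^esub> r) w = truncated_act P i N j r (truncated_act P i N j q w)"
proof -
  interpret group "P j" by (rule assms)
  show ?thesis
    using assms(2)
  proof (cases rule: truncated_words_cases[where j = j])
    case extend
    then have "truncated_act P i N j x w = append_letter P N j x w" for x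
      by (simp add: truncated_act_def)
    then show ?thesis using assms extend by (simp add: truncated_act_append_letter)
  next
    case Nil
    then show ?thesis by (simp add: truncated_act_Nil)
  next
    case (merge p v)
    then have "truncated_act P i N j x w = append_letter P N j (p \<otimes>\<^bsub>P j\<^esub> x) v" for x
      by (simp add: truncated_act_def)
    then show ?thesis using assms merge by (simp add: truncated_act_append_letter m_assoc)
  qed
qed

text \<open>
  The letters of a reduced word never merge, and up to length \<open>N\<close> none is ignored. So a short
  reduced word can be read off from its action on the empty word, which is how two different ones
  are told apart.
\<close>

lemma foldr_truncated_act:
  assumes "reduced I P i w" "length w \<le> N"
  shows "foldr (\<lambda>(j, p). truncated_act P i N j p) w [] = w"
  using assms by (induction w) (auto simp: truncated_act_def append_letter_def)

lemma finite_truncated_words: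
  assumes "finite J" "\<And>j. j \<in> I \<Longrightarrow> finite (carrier (P j))"
    and "\<And>j. j \<in> I - J \<Longrightarrow> carrier (P j) = {\<one>\<^bsub>P j\<^esub>}"
  shows "finite (truncated_words I P i N)"
proof -
  let ?L = "SIGMA j:I \<inter> J. carrier (P j)"
  have "set w \<subseteq> ?L" if "reduced I P i w" for w
    using that
  proof (induction w)
    case (Cons l w)
    then show ?case using assms(3) by (cases l) auto
  qed simp
  then have "truncated_words I P i N \<subseteq> {w. set w \<subseteq> ?L \<and> length w \<le> N}"
    unfolding truncated_words_def by blast
  moreover have "finite ?L" using assms(1,2) by (intro finite_SigmaI) auto
  ultimately show ?thesis
    using finite_lists_length_le finite_subset by blast
qed

section \<open>Separating finitely many elements of a residually finite group\<close>

text \<open>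
  A product of finite groups, one for each pair of different members of \<open>T\<close>, keeps \<open>T\<close> apart. If
  \<open>T\<close> has no two different members, the product is empty and hence trivial; this makes the groups
  for factors without letters trivial, so that the words form a finite set even for infinitely many
  factors.
\<close>

lemma residually_finite_group_separates:
  fixes G :: "('a, 'm) monoid_scheme"
  assumes "residually_finite_group G" "finite T" "T \<subseteq> carrier G"
  obtains P :: "('a \<times> 'a \<Rightarrow> nat) monoid" and \<alpha>
  where "group P" "finite (carrier P)" "\<alpha> \<in> hom G P" "inj_on \<alpha> T"
    and "T \<subseteq> {\<one>\<^bsub>G\<^esub>} \<Longrightarrow> carrier P = {\<one>\<^bsub>P\<^esub>}"
proof -
  interpret group G using assms(1) by (simp add: residually_finite_group_def)
  define S where "S = {(a, b). a \<in> T \<and> b \<in> T \<and> a \<noteq> b}"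
  have "\<exists>(F :: nat monoid) \<phi>. group F \<and> finite (carrier F) \<and> \<phi> \<in> hom G F \<and>
      \<phi> (fst s \<otimes>\<^bsub>G\<^esub> inv\<^bsub>G\<^esub> (snd s)) \<noteq> \<one>\<^bsub>F\<^esub>" if "s \<in> S" for s
  proof -
    have s: "fst s \<in> carrier G" "snd s \<in> carrier G" "fst s \<noteq> snd s"
      using that assms(3) by (auto simp: S_def)
    then have "fst s \<otimes>\<^bsub>G\<^esub> inv\<^bsub>G\<^esub> (snd s) \<noteq> \<one>\<^bsub>G\<^esub>"
      using inv_unique' inv_equality by (metis inv_closed inv_inv)
    then show ?thesis
      using s assms(1) unfolding residually_finite_group_def by blast
  qed
  then obtain F :: "'a \<times> 'a \<Rightarrow> nat monoid" and \<phi>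
    where F: "\<And>s. s \<in> S \<Longrightarrow> group (F s)" "\<And>s. s \<in> S \<Longrightarrow> finite (carrier (F s))"
      and \<phi>: "\<And>s. s \<in> S \<Longrightarrow> \<phi> s \<in> hom G (F s)"
        "\<And>s. s \<in> S \<Longrightarrow> \<phi> s (fst s \<otimes>\<^bsub>G\<^esub> inv\<^bsub>G\<^esub> (snd s)) \<noteq> \<one>\<^bsub>F s\<^esub>"
    by metis
  define P where "P = product_group S F"
  define \<alpha> where "\<alpha> a = (\<lambda>s\<in>S. \<phi> s a)" for a
  have "finite S"
    using assms(2) by (intro finite_subset[of S "T \<times> T"]) (auto simp: S_def)
  show thesis
  proof (rule that[of P \<alpha>])
    show "group P" unfolding P_def using F(1) by simp
    show "finite (carrier P)"
      unfolding P_def using F(2) \<open>finite S\<close> by (simp add: finite_PiE)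
    show "\<alpha> \<in> hom G P"
      using \<phi>(1) by (auto simp: hom_def P_def \<alpha>_def Pi_iff fun_eq_iff restrict_def)
    show "inj_on \<alpha> T"
    proof (rule inj_onI, rule ccontr)
      fix a b assume ab: "a \<in> T" "b \<in> T" "\<alpha> a = \<alpha> b" "a \<noteq> b"
      then have s: "(a, b) \<in> S" by (simp add: S_def)
      interpret h: group_hom G "F (a, b)" "\<phi> (a, b)"
        using F(1)[OF s] \<phi>(1)[OF s] by (intro group_hom.intro group_hom_axioms.intro is_group)
      have "\<phi> (a, b) a = \<phi> (a, b) b"
        using ab(3) s unfolding \<alpha>_def by (metis restrict_apply')
      then show False
        using \<phi>(2)[OF s] ab assms(3) by (auto simp: subset_iff h.H.r_inv)
    qed
    show "carrier P = {\<one>\<^bsub>P\<^esub>}" if "T \<subseteq> {\<one>\<^bsub>G\<^esub>}"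
    proof -
      have "S = {}" using that by (auto simp: S_def)
      then show ?thesis by (simp add: P_def restrict_def)
    qed
  qed
qed

section \<open>Finite quandles from permutation groups\<close>

text \<open>A separate name, since \<open>inv\<close> denotes inversion in a group here.\<close>

abbreviation perm_inv :: "('w \<Rightarrow> 'w) \<Rightarrow> 'w \<Rightarrow> 'w" where
  "perm_inv \<equiv> inv_into UNIV"

text \<open>
  Permutations under conjugation only see a group; the first component adds a point that the acting
  permutation moves along, so that cosets can be seen as well. Requiring that each permutation fix
  its own point makes the operation idempotent. Elements without a point always satisfy this.
\<close>

definition perm_quandle :: "'w set \<Rightarrow> ('w option \<times> ('w \<Rightarrow> 'w)) quandle" where
  "perm_quandle \<Omega> =
     \<lparr>carrier = {(c, \<pi>). \<pi> permutes \<Omega> \<and> set_option c \<subseteq> \<Omega> \<and> map_option \<pi> c = c},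
      qop = (\<lambda>(c, \<pi>) (d, \<sigma>). (map_option \<sigma> c, \<sigma> \<circ> \<pi> \<circ> perm_inv \<sigma>))\<rparr>"

lemma perm_quandle_carrier:
  "(c, \<pi>) \<in> carrier (perm_quandle \<Omega>) \<longleftrightarrow>
     \<pi> permutes \<Omega> \<and> set_option c \<subseteq> \<Omega> \<and> map_option \<pi> c = c"
  by (simp add: perm_quandle_def)

lemma perm_quandle_op:
  "(c, \<pi>) \<star>\<^bsub>perm_quandle \<Omega>\<^esub> (d, \<sigma>) = (map_option \<sigma> c, \<sigma> \<circ> \<pi> \<circ> perm_inv \<sigma>)"
  by (simp add: perm_quandle_def)

lemma set_option_map_permutes:
  "\<lbrakk>\<pi> permutes \<Omega>; set_option c \<subseteq> \<Omega>\<rbrakk> \<Longrightarrow> set_option (map_option \<pi> c) \<subseteq> \<Omega>"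
  by (cases c) (auto simp: permutes_in_image)

lemma map_option_comp_eq:
  "(\<And>x. f (g x) = x) \<Longrightarrow> map_option f (map_option g c) = c"
  by (cases c) auto

lemma perm_quandle_op_closed:
  assumes "(c, \<pi>) \<in> carrier (perm_quandle \<Omega>)" "\<sigma> permutes \<Omega>"
  shows "(map_option \<sigma> c, \<sigma> \<circ> \<pi> \<circ> perm_inv \<sigma>) \<in> carrier (perm_quandle \<Omega>)"
proof -
  have "map_option (\<sigma> \<circ> \<pi> \<circ> perm_inv \<sigma>) (map_option \<sigma> c) = map_option \<sigma> c"
    using assms by (cases c) (auto simp: perm_quandle_carrier permutes_inverses)
  then show ?thesis
    using assms by (simp add: perm_quandle_carrier set_option_map_permutes permutes_compose permutes_inv)
qed

lemma quandle_perm_quandle: "quandle (perm_quandle \<Omega>)"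
proof
  let ?F = "perm_quandle \<Omega>"
  have "(None, id) \<in> carrier ?F" by (simp add: perm_quandle_carrier permutes_id)
  then show "carrier ?F \<noteq> {}" by blast
  fix x y assume xy: "x \<in> carrier ?F" "y \<in> carrier ?F"
  obtain c \<pi> where x: "x = (c, \<pi>)" by fastforce
  obtain d \<sigma> where y: "y = (d, \<sigma>)" by fastforce
  have \<pi>: "\<pi> permutes \<Omega>" and c: "map_option \<pi> c = c" and \<sigma>: "\<sigma> permutes \<Omega>"
    using xy by (simp_all add: x y perm_quandle_carrier)
  note \<pi>_inv = permutes_inverses[OF \<pi>] and \<sigma>_inv = permutes_inverses[OF \<sigma>]
  show "x \<star>\<^bsub>?F\<^esub> y \<in> carrier ?F"
    using perm_quandle_op_closed[of c \<pi> \<Omega> \<sigma>] xy \<sigma> by (simp add: x y perm_quandle_op)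
  show "x \<star>\<^bsub>?F\<^esub> x = x"
    using c by (simp add: x perm_quandle_op fun_eq_iff \<pi>_inv)
  show "\<exists>!z. z \<in> carrier ?F \<and> x = z \<star>\<^bsub>?F\<^esub> y"
  proof (rule ex1I[where a = "(map_option (perm_inv \<sigma>) c, perm_inv \<sigma> \<circ> \<pi> \<circ> \<sigma>)"])
    have "(map_option (perm_inv \<sigma>) c, perm_inv \<sigma> \<circ> \<pi> \<circ> perm_inv (perm_inv \<sigma>)) \<in> carrier ?F"
      using xy(1) \<sigma> by (intro perm_quandle_op_closed) (simp_all add: x permutes_inv)
    then show "(map_option (perm_inv \<sigma>) c, perm_inv \<sigma> \<circ> \<pi> \<circ> \<sigma>) \<in> carrier ?F \<and>
        x = (map_option (perm_inv \<sigma>) c, perm_inv \<sigma> \<circ> \<pi> \<circ> \<sigma>) \<star>\<^bsub>?F\<^esub> y"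
      by (simp add: x y perm_quandle_op permutes_inv_inv[OF \<sigma>] fun_eq_iff \<sigma>_inv map_option_comp_eq
          del: option.map_comp)
    fix z assume z: "z \<in> carrier ?F \<and> x = z \<star>\<^bsub>?F\<^esub> y"
    obtain e \<tau> where "z = (e, \<tau>)" by fastforce
    then show "z = (map_option (perm_inv \<sigma>) c, perm_inv \<sigma> \<circ> \<pi> \<circ> \<sigma>)"
      using z by (simp add: x y perm_quandle_op fun_eq_iff \<sigma>_inv map_option_comp_eq
          del: option.map_comp)
  qed
  fix z assume z: "z \<in> carrier ?F"
  obtain e \<tau> where ze: "z = (e, \<tau>)" by fastforce
  have \<tau>: "\<tau> permutes \<Omega>"
    using z by (simp add: ze perm_quandle_carrier)
  have "perm_inv (\<tau> \<circ> \<sigma> \<circ> perm_inv \<tau>) = \<tau> \<circ> perm_inv \<sigma> \<circ> perm_inv \<tau>"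
    by (rule inv_equality) (simp_all add: \<sigma>_inv permutes_inverses[OF \<tau>])
  moreover have "map_option \<tau> (map_option \<sigma> c) = map_option (\<tau> \<circ> \<sigma> \<circ> perm_inv \<tau>) (map_option \<tau> c)"
    by (cases c) (simp_all add: permutes_inverses[OF \<tau>])
  ultimately show "(x \<star>\<^bsub>?F\<^esub> y) \<star>\<^bsub>?F\<^esub> z = (x \<star>\<^bsub>?F\<^esub> z) \<star>\<^bsub>?F\<^esub> (y \<star>\<^bsub>?F\<^esub> z)"
    by (simp add: x y ze perm_quandle_op fun_eq_iff permutes_inverses[OF \<tau>] del: option.map_comp)
qed

lemma finite_perm_quandle:
  assumes "finite \<Omega>"
  shows "finite (carrier (perm_quandle \<Omega>))"
proof (rule finite_subset)
  show "carrier (perm_quandle \<Omega>) \<subseteq> insert None (Some ` \<Omega>) \<times> {\<pi>. \<pi> permutes \<Omega>}"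
  proof
    fix s assume s: "s \<in> carrier (perm_quandle \<Omega>)"
    obtain c \<pi> where "s = (c, \<pi>)" by fastforce
    with s show "s \<in> insert None (Some ` \<Omega>) \<times> {\<pi>. \<pi> permutes \<Omega>}"
      by (cases c) (auto simp: perm_quandle_carrier)
  qed
  show "finite (insert None (Some ` \<Omega>) \<times> {\<pi>. \<pi> permutes \<Omega>})"
    using assms finite_permutations by blast
qed

lemma perm_quandle_div:
  assumes "(c, \<pi>) \<in> carrier (perm_quandle \<Omega>)" "(d, \<sigma>) \<in> carrier (perm_quandle \<Omega>)"
  shows "fst (quandle_div (perm_quandle \<Omega>) (c, \<pi>) (d, \<sigma>)) = map_option (perm_inv \<sigma>) c"
proof -
  obtain e \<tau> where e: "quandle_div (perm_quandle \<Omega>) (c, \<pi>) (d, \<sigma>) = (e, \<tau>)" by fastforce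
  have "(e, \<tau>) \<star>\<^bsub>perm_quandle \<Omega>\<^esub> (d, \<sigma>) = (c, \<pi>)"
    using quandle.div_op[OF quandle_perm_quandle assms] by (simp add: e)
  moreover have "\<sigma> permutes \<Omega>"
    using assms by (simp add: perm_quandle_carrier)
  ultimately show ?thesis
    by (auto simp: e perm_quandle_op map_option_comp_eq permutes_inverses simp del: option.map_comp)
qed

text \<open>
  Here \<open>\<rho>\<close> is a right action of the associated group. Giving every element of \<open>Q\<close> the same point \<open>c\<close>
  and the permutation by which its generator acts yields a homomorphism, because the relations of
  the associated group turn the operation of \<open>Q\<close> into conjugation and \<open>c\<close> is fixed by the whole
  group. The action of the associated group on the target then moves points by \<open>\<rho>\<close>.
\<close>

locale as_perm_action =
  fixes Q :: "('a, 'm) quandle_scheme" and \<Omega> :: "'w set"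
    and \<rho> :: "(bool \<times> 'a) list set \<Rightarrow> 'w \<Rightarrow> 'w" and c :: "'w option"
  assumes quandle_Q: "quandle Q" and group_as: "group (associated_group Q)"
    and closed: "\<lbrakk>a \<in> carrier (associated_group Q); w \<in> \<Omega>\<rbrakk> \<Longrightarrow> \<rho> a w \<in> \<Omega>"
    and one: "w \<in> \<Omega> \<Longrightarrow> \<rho> \<one>\<^bsub>associated_group Q\<^esub> w = w"
    and mult: "\<lbrakk>a \<in> carrier (associated_group Q); b \<in> carrier (associated_group Q); w \<in> \<Omega>\<rbrakk>
      \<Longrightarrow> \<rho> (a \<otimes>\<^bsub>associated_group Q\<^esub> b) w = \<rho> b (\<rho> a w)"
    and point: "set_option c \<subseteq> \<Omega>"
    and fixed: "a \<in> carrier (associated_group Q) \<Longrightarrow> map_option (\<rho> a) c = c"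
begin

interpretation group "associated_group Q" by (rule group_as)

text \<open>A permutation of \<open>\<Omega>\<close> has to be the identity outside \<open>\<Omega>\<close>, where \<open>\<rho>\<close> is arbitrary.\<close>

definition \<rho>' where "\<rho>' a w = (if w \<in> \<Omega> then \<rho> a w else w)"

definition perm_hom where "perm_hom x = (c, \<rho>' (as_gen Q x))"

lemma \<rho>'_one: "\<rho>' \<one>\<^bsub>associated_group Q\<^esub> = id"
  by (auto simp: \<rho>'_def one)

lemma \<rho>'_mult:
  "\<lbrakk>a \<in> carrier (associated_group Q); b \<in> carrier (associated_group Q)\<rbrakk>
    \<Longrightarrow> \<rho>' (a \<otimes>\<^bsub>associated_group Q\<^esub> b) = \<rho>' b \<circ> \<rho>' a"
  by (auto simp: \<rho>'_def mult closed fun_eq_iff)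

lemma \<rho>'_inv:
  assumes "a \<in> carrier (associated_group Q)"
  shows "perm_inv (\<rho>' a) = \<rho>' (inv\<^bsub>associated_group Q\<^esub> a)"
  using \<rho>'_mult[of a "inv\<^bsub>associated_group Q\<^esub> a"] \<rho>'_mult[of "inv\<^bsub>associated_group Q\<^esub> a" a] assms
  by (intro inv_unique_comp) (simp_all add: \<rho>'_one)

lemma \<rho>'_permutes:
  assumes "a \<in> carrier (associated_group Q)"
  shows "\<rho>' a permutes \<Omega>"
proof -
  have "bij (\<rho>' a)"
    using \<rho>'_mult[of a "inv\<^bsub>associated_group Q\<^esub> a"] \<rho>'_mult[of "inv\<^bsub>associated_group Q\<^esub> a" a] assms
    by (intro o_bij[of "\<rho>' (inv\<^bsub>associated_group Q\<^esub> a)"]) (simp_all add: \<rho>'_one)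
  then show ?thesis
    by (simp add: permutes_def bij_iff \<rho>'_def)
qed

lemma perm_hom: "perm_hom \<in> quandle_hom Q (perm_quandle \<Omega>)"
proof (rule quandle_homI)
  have c_fixed: "map_option (\<rho>' a) c = c" if "a \<in> carrier (associated_group Q)" for a
    using fixed[OF that] point by (cases c) (auto simp: \<rho>'_def)
  fix x y assume xy: "x \<in> carrier Q" "y \<in> carrier Q"
  then have gen: "as_gen Q x \<in> carrier (associated_group Q)" "as_gen Q y \<in> carrier (associated_group Q)"
    by (simp_all only: as_gen_closed)
  show "perm_hom x \<in> carrier (perm_quandle \<Omega>)"
    using gen point by (simp add: perm_hom_def perm_quandle_carrier \<rho>'_permutes c_fixed)
  have "\<rho>' (as_gen Q (x \<star>\<^bsub>Q\<^esub> y)) = \<rho>' (as_gen Q y) \<circ> (\<rho>' (as_gen Q x) \<circ> perm_inv (\<rho>' (as_gen Q y)))"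
    unfolding as_gen_op[OF group_as quandle_Q xy] \<rho>'_inv[OF gen(2)]
    using gen by (simp add: \<rho>'_mult)
  then show "perm_hom (x \<star>\<^bsub>Q\<^esub> y) = perm_hom x \<star>\<^bsub>perm_quandle \<Omega>\<^esub> perm_hom y"
    using gen by (simp add: perm_hom_def perm_quandle_op c_fixed o_assoc)
qed

lemma fst_as_act_perm_hom:
  assumes s: "s \<in> carrier (perm_quandle \<Omega>)" and a: "a \<in> carrier (associated_group Q)"
  shows "fst (as_act (perm_quandle \<Omega>) perm_hom a s) = map_option (\<rho> a) (fst s)"
proof -
  let ?F = "perm_quandle \<Omega>"
  have "fst (word_act ?F perm_hom w s) = map_option (\<rho>' (as_class Q w)) (fst s)"
    if "w \<in> group_words (carrier Q)" for w
    using that s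
  proof (induction w arbitrary: s)
    case Nil
    then show ?case using \<rho>'_one by (simp add: one_associated_group id_def option.map_ident)
  next
    case (Cons l w)
    obtain b x where l: "l = (b, x)" by fastforce
    have x: "x \<in> carrier Q" and w: "w \<in> group_words (carrier Q)"
      using Cons.prems l by auto
    define t where "t = (if b then s \<star>\<^bsub>?F\<^esub> perm_hom x else quandle_div ?F s (perm_hom x))"
    have hom_x: "perm_hom x \<in> carrier ?F"
      using x by (rule quandle_homD(1)[OF perm_hom])
    have t: "t \<in> carrier ?F"
      unfolding t_def
      using quandle.qop_closed[OF quandle_perm_quandle Cons.prems(2) hom_x]
        quandle.div_closed[OF quandle_perm_quandle Cons.prems(2) hom_x] by simp
    have gen: "as_class Q [(b, x)] \<in> carrier (associated_group Q)" "as_gen Q x \<in> carrier (associated_group Q)"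
      "as_class Q w \<in> carrier (associated_group Q)"
      using x w by (simp_all add: carrier_associated_group)
    have "fst t = map_option (\<rho>' (as_class Q [(b, x)])) (fst s)"
    proof (cases b)
      case True
      then show ?thesis by (cases s) (simp add: t_def perm_hom_def perm_quandle_op)
    next
      case False
      then show ?thesis
        using perm_quandle_div[of "fst s" "snd s" \<Omega> c "\<rho>' (as_gen Q x)"] Cons.prems(2) hom_x
        by (simp add: t_def perm_hom_def \<rho>'_inv[OF gen(2)] inv_as_gen[OF group_as x])
    qed
    moreover have "as_class Q ((b, x) # w) = as_class Q [(b, x)] \<otimes>\<^bsub>associated_group Q\<^esub> as_class Q w"
      using x w by (simp add: mult_associated_group)
    moreover have "word_act ?F perm_hom (l # w) s = word_act ?F perm_hom w t"
      by (simp add: l t_def)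
    ultimately show ?case
      using Cons.IH[OF w t] gen by (simp add: l \<rho>'_mult option.map_comp o_def)
  qed
  moreover have "map_option (\<rho>' a) (fst s) = map_option (\<rho> a) (fst s)"
    using s by (cases s; cases "fst s") (auto simp: perm_quandle_carrier \<rho>'_def)
  ultimately show ?thesis
    using a s unfolding carrier_associated_group
    by (auto simp: as_act_class[OF quandle_perm_quandle perm_hom])
qed

end

section \<open>The free product as a coproduct\<close>

locale quandle_coproduct =
  fixes I :: "'i set" and Q :: "'i \<Rightarrow> 'a quandle" and X :: "'i \<Rightarrow> 'g set"
    and R :: "'i \<Rightarrow> ('g qterm \<times> 'g qterm) set"
  assumes index_nonempty: "I \<noteq> {}"
    and quandle_Q: "i \<in> I \<Longrightarrow> quandle (Q i)"
    and presentation: "i \<in> I \<Longrightarrow> quandle_presentation (Q i) (X i) (R i)"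
    and disjoint: "disjoint_family_on X I"
begin

abbreviation F where "F \<equiv> quandle_free_product I X R"

abbreviation factor_pres where "factor_pres i \<equiv> presented_quandle (X i) (R i)"

definition factor_iso where "factor_iso i = (SOME f. f \<in> quandle_iso (Q i) (factor_pres i))"

definition factor_iso_inv where "factor_iso_inv i = inv_into (carrier (Q i)) (factor_iso i)"

abbreviation factor_cls where "factor_cls i \<equiv> quandle_pres.cls (X i) (R i)"

lemma factor_iso:
  assumes "i \<in> I"
  shows "factor_iso i \<in> quandle_iso (Q i) (factor_pres i)"
  using presentation[OF assms] unfolding quandle_presentation_def factor_iso_def
  by (metis all_not_in_conv someI_ex)

lemma factor_iso_hom: "i \<in> I \<Longrightarrow> factor_iso i \<in> quandle_hom (Q i) (factor_pres i)"
  using factor_iso unfolding quandle_iso_def by blast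

lemma factor_quandle_pres:
  assumes "i \<in> I"
  shows "quandle_pres (X i) (R i)"
proof
  obtain x where "x \<in> carrier (Q i)"
    using quandle.carrier_nonempty[OF quandle_Q[OF assms]] by blast
  then have "carrier (factor_pres i) \<noteq> {}"
    using quandle_homD(1)[OF factor_iso_hom[OF assms]] by blast
  moreover have "t \<notin> qterms {}" for t :: "'g qterm"
    by (induction t) auto
  ultimately show "X i \<noteq> {}"
    by (auto simp: presented_quandle_def carrier_quotient_quandle carrier_free_quandle)
  show "R i \<subseteq> qterms (X i) \<times> qterms (X i)"
    using presentation[OF assms] by (simp add: quandle_presentation_def)
qed

lemma qterms_factor: "\<lbrakk>i \<in> I; t \<in> qterms (X i)\<rbrakk> \<Longrightarrow> t \<in> qterms (\<Union>i\<in>I. X i)"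
  by (auto simp: qterms_def)

sublocale quandle_pres "\<Union>i\<in>I. X i" "\<Union>i\<in>I. R i"
proof
  show "(\<Union>i\<in>I. X i) \<noteq> {}"
    using index_nonempty quandle_pres.gens_nonempty[OF factor_quandle_pres] by blast
  show "(\<Union>i\<in>I. R i) \<subseteq> qterms (\<Union>i\<in>I. X i) \<times> qterms (\<Union>i\<in>I. X i)"
    using quandle_pres.rels[OF factor_quandle_pres] qterms_factor by blast
qed

lemma quandle_F: "quandle F"
  using quandle_presented by (simp add: quandle_free_product_def)

lemma factor_iso_inv_hom: "i \<in> I \<Longrightarrow> factor_iso_inv i \<in> quandle_hom (factor_pres i) (Q i)"
  unfolding factor_iso_inv_def by (rule quandle_iso_inv_into[OF factor_iso quandle_Q])

lemma factor_iso_inv: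
  assumes "i \<in> I"
  shows "x \<in> carrier (Q i) \<Longrightarrow> factor_iso_inv i (factor_iso i x) = x"
    and "A \<in> carrier (factor_pres i) \<Longrightarrow> factor_iso i (factor_iso_inv i A) = A"
proof -
  have "inj_on (factor_iso i) (carrier (Q i))" "factor_iso i ` carrier (Q i) = carrier (factor_pres i)"
    using factor_iso[OF assms] by (auto simp: quandle_iso_def bij_betw_def)
  then show "x \<in> carrier (Q i) \<Longrightarrow> factor_iso_inv i (factor_iso i x) = x"
    and "A \<in> carrier (factor_pres i) \<Longrightarrow> factor_iso i (factor_iso_inv i A) = A"
    by (simp_all add: factor_iso_inv_def f_inv_into_f)
qed

definition factor_map where
  "factor_map i = (SOME \<Phi>. \<Phi> \<in> quandle_hom (factor_pres i) F \<and>
     (\<forall>t\<in>qterms (X i). \<Phi> (factor_cls i t) = cls t))"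

definition incl where "incl i = factor_map i \<circ> factor_iso i"

lemma factor_map:
  assumes i: "i \<in> I"
  shows "factor_map i \<in> quandle_hom (factor_pres i) F \<and>
    (\<forall>t\<in>qterms (X i). factor_map i (factor_cls i t) = cls t)"
proof -
  interpret i: quandle_pres "X i" "R i" by (rule factor_quandle_pres[OF i])
  have eval: "qeval F (\<lambda>x. cls (QGen x)) t = cls t" if "t \<in> qterms (X i)" for t
    using qeval_cls[OF qterms_factor[OF i that]] by (simp add: quandle_free_product_def)
  obtain \<Phi> where "\<Phi> \<in> quandle_hom (factor_pres i) F"
    and "\<And>t. t \<in> qterms (X i) \<Longrightarrow> \<Phi> (factor_cls i t) = qeval F (\<lambda>x. cls (QGen x)) t"
  proof (rule i.presented_hom_exists[OF quandle_F])
    show "cls (QGen x) \<in> carrier F" if "x \<in> X i" for x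
      using qterms_factor[OF i, of "QGen x"] that cls_closed[of "QGen x"]
      by (simp add: quandle_free_product_def)
    show "qeval F (\<lambda>x. cls (QGen x)) s = qeval F (\<lambda>x. cls (QGen x)) t" if st: "(s, t) \<in> R i" for s t
    proof -
      have "s \<in> qterms (X i)" "t \<in> qterms (X i)" "cls s = cls t"
        using st i i.rels cls_rel[of s t] by auto
      then show ?thesis by (simp add: eval)
    qed
  qed blast
  then have "\<Phi> \<in> quandle_hom (factor_pres i) F \<and>
      (\<forall>t\<in>qterms (X i). \<Phi> (factor_cls i t) = cls t)"
    by (simp add: eval)
  then show ?thesis
    unfolding factor_map_def
    by (rule someI[of "\<lambda>\<Phi>. \<Phi> \<in> quandle_hom (factor_pres i) F \<and>
      (\<forall>t\<in>qterms (X i). \<Phi> (factor_cls i t) = cls t)"])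
qed

lemma incl_hom: "i \<in> I \<Longrightarrow> incl i \<in> quandle_hom (Q i) F"
  unfolding incl_def using factor_map factor_iso_hom quandle_hom_compose by blast

text \<open>
  The universal property of the coproduct. A generator lies in exactly one \<open>X i\<close>, so the given
  homomorphisms determine its value, and each relation holds since it already holds in its factor.
\<close>

lemma free_product_hom_exists:
  assumes F': "quandle F'" and f: "\<And>i. i \<in> I \<Longrightarrow> f i \<in> quandle_hom (Q i) F'"
  obtains \<Phi> where "\<Phi> \<in> quandle_hom F F'"
    and "\<And>i x. \<lbrakk>i \<in> I; x \<in> carrier (Q i)\<rbrakk> \<Longrightarrow> \<Phi> (incl i x) = f i x"
proof -
  define h where "h i = f i \<circ> factor_iso_inv i" for i
  define idx where "idx x = (THE i. i \<in> I \<and> x \<in> X i)" for x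
  define g where "g x = h (idx x) (factor_cls (idx x) (QGen x))" for x
  have idx: "idx x = i" if "i \<in> I" "x \<in> X i" for i x
    unfolding idx_def using that disjoint by (intro the_equality) (auto simp: disjoint_family_on_def)
  have h: "h i \<in> quandle_hom (factor_pres i) F'" if "i \<in> I" for i
    unfolding h_def by (rule quandle_hom_compose[OF factor_iso_inv_hom[OF that] f[OF that]])
  have eval: "qeval F' g t = h i (factor_cls i t)" if i: "i \<in> I" and "t \<in> qterms (X i)" for i t
  proof -
    interpret i: quandle_pres "X i" "R i" by (rule factor_quandle_pres[OF i])
    show ?thesis
      using that(2)
      by (induction t) (simp_all add: g_def idx[OF i] i.cls_op i.cls_div quandle_homD(2)[OF h[OF i]]
          quandle_hom_div[OF i.quandle_presented F' h[OF i]] i.cls_closed)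
  qed
  obtain \<Phi> where \<Phi>: "\<Phi> \<in> quandle_hom F F'"
    and \<Phi>_cls: "\<And>t. t \<in> qterms (\<Union>i\<in>I. X i) \<Longrightarrow> \<Phi> (cls t) = qeval F' g t"
  proof (rule presented_hom_exists[OF F'])
    fix x assume "x \<in> (\<Union>i\<in>I. X i)"
    then obtain i where i: "i \<in> I" "x \<in> X i" by blast
    then have "factor_cls i (QGen x) \<in> carrier (factor_pres i)"
      by (intro quandle_pres.cls_closed[OF factor_quandle_pres]) auto
    then show "g x \<in> carrier F'"
      unfolding g_def idx[OF i] by (rule quandle_homD(1)[OF h[OF i(1)]])
  next
    fix s t assume "(s, t) \<in> (\<Union>i\<in>I. R i)"
    then obtain i where i: "i \<in> I" "(s, t) \<in> R i" by blast
    then have "s \<in> qterms (X i)" "t \<in> qterms (X i)" "factor_cls i s = factor_cls i t"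
      using quandle_pres.rels[OF factor_quandle_pres[OF i(1)]]
        quandle_pres.cls_rel[OF factor_quandle_pres[OF i(1)]] by auto
    then show "qeval F' g s = qeval F' g t"
      using eval[OF i(1)] by simp
  qed (unfold quandle_free_product_def, blast)
  show thesis
  proof (rule that[OF \<Phi>])
    fix i x assume i: "i \<in> I" and x: "x \<in> carrier (Q i)"
    have "factor_iso i x \<in> carrier (factor_pres i)"
      using quandle_homD(1)[OF factor_iso_hom[OF i] x] .
    then obtain t where t: "t \<in> qterms (X i)" "factor_iso i x = factor_cls i t"
      using quandle_pres.carrier_presented[OF factor_quandle_pres[OF i]] by auto
    then have "incl i x = cls t"
      using factor_map[OF i] by (simp add: incl_def)
    then have "\<Phi> (incl i x) = h i (factor_iso i x)"
      using t eval[OF i] \<Phi>_cls[OF qterms_factor[OF i t(1)]] by simp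
    then show "\<Phi> (incl i x) = f i x"
      using i x by (simp add: h_def factor_iso_inv)
  qed
qed

lemma cls_gen_eq_incl:
  assumes "x \<in> (\<Union>i\<in>I. X i)"
  obtains i y where "i \<in> I" "y \<in> carrier (Q i)" "cls (QGen x) = incl i y"
proof -
  obtain i where i: "i \<in> I" "x \<in> X i" using assms by blast
  interpret i: quandle_pres "X i" "R i" by (rule factor_quandle_pres[OF i(1)])
  have c: "factor_cls i (QGen x) \<in> carrier (factor_pres i)"
    using i by (simp add: i.cls_closed)
  have "incl i (factor_iso_inv i (factor_cls i (QGen x))) = cls (QGen x)"
    using factor_map[OF i(1)] c i by (simp add: incl_def factor_iso_inv)
  then show thesis
    using that[OF i(1)] quandle_homD(1)[OF factor_iso_inv_hom[OF i(1)] c] by metis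
qed

end

section \<open>Normal forms in the free product\<close>

locale quandle_coproduct_groups = quandle_coproduct I Q X R
  for I :: "'i set" and Q :: "'i \<Rightarrow> 'a quandle" and X :: "'i \<Rightarrow> 'g set"
    and R :: "'i \<Rightarrow> ('g qterm \<times> 'g qterm) set" +
  assumes group_as: "i \<in> I \<Longrightarrow> group (associated_group (Q i))"
begin

abbreviation As where "As i \<equiv> associated_group (Q i)"

text \<open>
  The letters of a word, here called syllables, act on a base point in the factor \<open>i\<close>. Reducedness
  with respect to \<open>i\<close> forbids a first syllable from the associated group of \<open>Q i\<close>, as it could be
  absorbed into the base point.
\<close>

definition nf where
  "nf i y w = foldr (\<lambda>(j, a). as_act F (incl j) a) w (incl i y)"

lemma nf_simps [simp]:
  "nf i y [] = incl i y"
  "nf i y ((j, a) # w) = as_act F (incl j) a (nf i y w)"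
  by (simp_all add: nf_def)

lemma nf_closed:
  assumes "i \<in> I" "y \<in> carrier (Q i)" "reduced I As i w"
  shows "nf i y w \<in> carrier F"
  using assms(3)
proof (induction w)
  case Nil
  then show ?case using assms quandle_homD(1)[OF incl_hom] by simp
next
  case (Cons l w)
  then show ?case
    by (cases l) (auto intro: as_act_closed[OF quandle_F incl_hom])
qed

text \<open>
  A nontrivial syllable acting on a normal form either becomes a new last syllable, or merges with
  the last one and possibly cancels it, or, if there is none and it comes from the factor of the
  base point, moves the base point.
\<close>

lemma as_act_nf:
  assumes i: "i \<in> I" "y \<in> carrier (Q i)" and w: "reduced I As i w"
    and j: "j \<in> I" "a \<in> carrier (As j)"
  shows "\<exists>y' w'. y' \<in> carrier (Q i) \<and> reduced I As i w' \<and> as_act F (incl j) a (nf i y w) = nf i y' w'"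
proof -
  interpret group "As j" by (rule group_as[OF j(1)])
  note hom_j = incl_hom[OF j(1)]
  have new: "\<exists>y' w'. y' \<in> carrier (Q i) \<and> reduced I As i w' \<and> as_act F (incl j) b (nf i y v) = nf i y' w'"
    if "reduced I As i v" "j \<noteq> last_index i v" "b \<in> carrier (As j)" for v b
  proof (cases "b = \<one>\<^bsub>As j\<^esub>")
    case True
    then have "as_act F (incl j) b (nf i y v) = nf i y v"
      using as_act_one[OF quandle_F hom_j nf_closed[OF i that(1)]] by simp
    then show ?thesis using i that by blast
  next
    case False
    then have "reduced I As i ((j, b) # v)"
      using that j by simp
    moreover have "as_act F (incl j) b (nf i y v) = nf i y ((j, b) # v)" by simp
    ultimately show ?thesis using i by blast
  qed
  show ?thesis
  proof (cases "j = last_index i w")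
    case False
    then show ?thesis using new[OF w _ j(2)] by blast
  next
    case True
    show ?thesis
    proof (cases w)
      case Nil
      have id: "id \<in> quandle_hom (Q i) (Q i)" by (rule quandle_homI) auto
      have a: "a \<in> carrier (As i)" and ji: "j = i" using j True Nil by auto
      have "as_act F (incl j) a (incl i y) = incl i (as_act (Q i) id a y)"
        unfolding ji
        using as_act_natural[OF quandle_Q[OF i(1)] id quandle_F incl_hom[OF i(1)] a i(2) incl_hom[OF i(1)]]
        by simp
      moreover have "as_act (Q i) id a y \<in> carrier (Q i)"
        by (rule as_act_closed[OF quandle_Q[OF i(1)] id a i(2)])
      ultimately show ?thesis using Nil by (intro exI[of _ "as_act (Q i) id a y"] exI[of _ "[]"]) simp
    next
      case (Cons l v)
      then obtain b where l: "w = (j, b) # v" using True by (cases l) auto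
      then have v: "reduced I As i v" "j \<noteq> last_index i v" "b \<in> carrier (As j)" using w by auto
      then have "as_act F (incl j) a (nf i y w) = as_act F (incl j) (b \<otimes>\<^bsub>As j\<^esub> a) (nf i y v)"
        using as_act_mult[OF quandle_F hom_j v(3) j(2) nf_closed[OF i v(1)]] l by simp
      then show ?thesis using new[OF v(1,2), of "b \<otimes>\<^bsub>As j\<^esub> a"] v(3) j(2) by simp
    qed
  qed
qed

text \<open>
  The elements with a normal form include the images of the factors and are closed under the
  action of the associated groups, in particular under translations by generators.
\<close>

lemma nf_exists:
  assumes "A \<in> carrier F"
  shows "\<exists>i y w. i \<in> I \<and> y \<in> carrier (Q i) \<and> reduced I As i w \<and> A = nf i y w"
proof -
  let ?N = "\<lambda>A. \<exists>i y w. i \<in> I \<and> y \<in> carrier (Q i) \<and> reduced I As i w \<and> A = nf i y w"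
  have act: "?N (as_act F (incl j) a A)" if A: "?N A" and j: "j \<in> I" "a \<in> carrier (As j)" for A j a
  proof -
    from A obtain i y w where A: "i \<in> I" "y \<in> carrier (Q i)" "reduced I As i w" "A = nf i y w"
      by blast
    show ?thesis
      using as_act_nf[OF A(1-3) j] A(1) unfolding A(4) by blast
  qed
  have *: "?N (cls (QGen x))" and **: "A \<in> carrier F \<Longrightarrow> ?N A \<Longrightarrow>
      ?N (A \<star>\<^bsub>F\<^esub> cls (QGen x)) \<and> ?N (quandle_div F A (cls (QGen x)))"
    if x: "x \<in> (\<Union>i\<in>I. X i)" for x A
  proof -
    obtain j y where j: "j \<in> I" "y \<in> carrier (Q j)" "cls (QGen x) = incl j y"
      using cls_gen_eq_incl[OF x] .
    then have "reduced I As j [] \<and> cls (QGen x) = nf j y []" by simp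
    then show "?N (cls (QGen x))" using j(1,2) by blast
    assume A: "A \<in> carrier F" "?N A"
    have gens: "as_gen (Q j) y \<in> carrier (As j)" "as_class (Q j) [(False, y)] \<in> carrier (As j)"
      using j by (simp_all add: carrier_associated_group)
    show "?N (A \<star>\<^bsub>F\<^esub> cls (QGen x)) \<and> ?N (quandle_div F A (cls (QGen x)))"
      using act[OF A(2) j(1) gens(1)] act[OF A(2) j(1) gens(2)]
      unfolding j(3) as_act_gen[OF quandle_F incl_hom[OF j(1)] j(2) A(1)] by blast
  qed
  have "A \<in> carrier (presented_quandle (\<Union>i\<in>I. X i) (\<Union>i\<in>I. R i))"
    using assms by (simp add: quandle_free_product_def)
  then show ?thesis
  proof (induction rule: presented_induct)
    case (gen x)
    then show ?case by (rule *)
  next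
    case (op A x)
    then show ?case using **[of x A] by (simp add: quandle_free_product_def)
  next
    case (div A x)
    then show ?case using **[of x A] by (simp add: quandle_free_product_def)
  qed
qed

section \<open>Separating normal forms\<close>

text \<open>
  All other factors can be collapsed to a point of a finite image of \<open>Q i\<close>. The common syllables then
  act on that image by a permutation, which keeps the images of the base points apart.
\<close>

lemma separate_base_points:
  assumes i: "i \<in> I" "residually_finite_quandle (Q i)"
    and xy: "x \<in> carrier (Q i)" "y \<in> carrier (Q i)" "x \<noteq> y" and w: "reduced I As i w"
  shows "\<exists>(F' :: nat quandle) \<Phi>. quandle F' \<and> finite (carrier F') \<and> \<Phi> \<in> quandle_hom F F' \<and>
    \<Phi> (nf i x w) \<noteq> \<Phi> (nf i y w)"
proof -
  obtain F' :: "nat quandle" and \<psi> where F': "quandle F'" "finite (carrier F')"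
    and \<psi>: "\<psi> \<in> quandle_hom (Q i) F'" "\<psi> x \<noteq> \<psi> y"
    using i(2) xy unfolding residually_finite_quandle_def by blast
  define f where "f j = (if j = i then \<psi> else (\<lambda>_. \<psi> x))" for j
  have f: "f j \<in> quandle_hom (Q j) F'" if "j \<in> I" for j
    by (simp add: f_def \<psi>(1) quandle_hom_const[OF F'(1) quandle_homD(1)[OF \<psi>(1) xy(1)]])
  obtain \<Phi> where \<Phi>: "\<Phi> \<in> quandle_hom F F'"
    and \<Phi>_incl: "\<And>i x. \<lbrakk>i \<in> I; x \<in> carrier (Q i)\<rbrakk> \<Longrightarrow> \<Phi> (incl i x) = f i x"
    using free_product_hom_exists[OF F'(1) f] by blast
  have "\<Phi> (nf i x w) \<noteq> \<Phi> (nf i y w)"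
    using w
  proof (induction w)
    case Nil
    then show ?case using i xy \<psi> by (simp add: \<Phi>_incl f_def)
  next
    case (Cons l w)
    obtain j a where l: "l = (j, a)" by fastforce
    have j: "j \<in> I" "a \<in> carrier (As j)" and w: "reduced I As i w"
      using Cons.prems l by auto
    note nf = nf_closed[OF i(1) xy(1) w] nf_closed[OF i(1) xy(2) w]
    have "\<Phi> (as_act F (incl j) a s) = as_act F' (f j) a (\<Phi> s)" if "s \<in> carrier F" for s
      using as_act_natural[OF quandle_F incl_hom[OF j(1)] F'(1) \<Phi> j(2) that f[OF j(1)]] \<Phi>_incl[OF j(1)]
      by simp
    then show ?case
      using Cons.IH[OF w] nf l quandle_homD(1)[OF \<Phi>]
        as_act_inj[OF group_as[OF j(1)] F'(1) f[OF j(1)] j(2)]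
      by auto
  qed
  then show ?thesis using F' \<Phi> by blast
qed

text \<open>
  Map every factor to a quandle of permutations of truncated words over finite groups, where the
  factor \<open>i\<close> carries the empty word as its point and the others carry none. The point component of
  the image of a normal form with base point in the factor \<open>i\<close> is its word of syllables, read in the
  finite groups; base points from other factors leave no point at all.
\<close>

lemma separate_words:
  assumes rf: "\<And>j. j \<in> I \<Longrightarrow> residually_finite_group (As j)"
    and i: "i \<in> I" "x \<in> carrier (Q i)" and u: "reduced I As i u"
    and k: "k \<in> I" "y \<in> carrier (Q k)" and v: "reduced I As k v"
    and neq: "(i, u) \<noteq> (k, v)"
  shows "\<exists>(F' :: nat quandle) \<Phi>. quandle F' \<and> finite (carrier F') \<and> \<Phi> \<in> quandle_hom F F' \<and>
    \<Phi> (nf i x u) \<noteq> \<Phi> (nf k y v)"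
proof -
  have letters: "j \<in> I \<and> a \<in> carrier (As j)" if "reduced I As i' w" "(j, a) \<in> set w" for i' w j a
    using that by (induction w) auto
  \<comment> \<open>The identity is included so that an injective map on \<open>T j\<close> sends no syllable to the identity.\<close>
  define T where "T j = insert \<one>\<^bsub>As j\<^esub> {a. (j, a) \<in> set u \<union> set v}" for j
  have T_fin: "finite (T j)" for j
  proof -
    have "{a. (j, a) \<in> set u \<union> set v} \<subseteq> snd ` (set u \<union> set v)" by force
    then show ?thesis unfolding T_def by (meson List.finite_set finite_UnI finite_imageI finite_insert finite_subset)
  qed
  have T_sub: "T j \<subseteq> carrier (As j)" if "j \<in> I" for j
    using letters[OF u] letters[OF v] group.is_monoid[OF group_as[OF that]] monoid.one_closed
    unfolding T_def by auto
  have "\<exists>(P :: ((bool \<times> 'a) list set \<times> (bool \<times> 'a) list set \<Rightarrow> nat) monoid) \<alpha>.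
      group P \<and> finite (carrier P) \<and> \<alpha> \<in> hom (As j) P \<and> inj_on \<alpha> (T j) \<and>
      (T j \<subseteq> {\<one>\<^bsub>As j\<^esub>} \<longrightarrow> carrier P = {\<one>\<^bsub>P\<^esub>})" if "j \<in> I" for j
    by (rule residually_finite_group_separates[OF rf[OF that] T_fin T_sub[OF that]]) blast
  then obtain P :: "'i \<Rightarrow> ((bool \<times> 'a) list set \<times> (bool \<times> 'a) list set \<Rightarrow> nat) monoid" and \<alpha>
    where P: "\<And>j. j \<in> I \<Longrightarrow> group (P j)" "\<And>j. j \<in> I \<Longrightarrow> finite (carrier (P j))"
      and \<alpha>: "\<And>j. j \<in> I \<Longrightarrow> \<alpha> j \<in> hom (As j) (P j)" "\<And>j. j \<in> I \<Longrightarrow> inj_on (\<alpha> j) (T j)"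
      and P_triv: "\<And>j. \<lbrakk>j \<in> I; T j \<subseteq> {\<one>\<^bsub>As j\<^esub>}\<rbrakk> \<Longrightarrow> carrier (P j) = {\<one>\<^bsub>P j\<^esub>}"
    by metis
  define N where "N = max (length u) (length v)"
  define \<Omega> where "\<Omega> = truncated_words I P i N"
  define \<rho> where "\<rho> j a = truncated_act P i N j (\<alpha> j a)" for j a
  define c :: "'i \<Rightarrow> ('i \<times> ((bool \<times> 'a) list set \<times> (bool \<times> 'a) list set \<Rightarrow> nat)) list option"
    where "c j = (if j = i then Some [] else None)" for j
  define f where "f j = as_perm_action.perm_hom (Q j) \<Omega> (\<rho> j) (c j)" for j
  have \<alpha>_hom: "group_hom (As j) (P j) (\<alpha> j)" if "j \<in> I" for j
    using P(1) \<alpha>(1) group_as that by (intro group_hom.intro group_hom_axioms.intro)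
  have action: "as_perm_action (Q j) \<Omega> (\<rho> j) (c j)" if j: "j \<in> I" for j
  proof -
    interpret group_hom "As j" "P j" "\<alpha> j" by (rule \<alpha>_hom[OF j])
    show ?thesis
    proof (rule as_perm_action.intro[OF quandle_Q[OF j] group_as[OF j]])
      fix a b w assume a: "a \<in> carrier (As j)" and b: "b \<in> carrier (As j)" and w: "w \<in> \<Omega>"
      show "\<rho> j (a \<otimes>\<^bsub>As j\<^esub> b) w = \<rho> j b (\<rho> j a w)"
        using truncated_act_mult[where P = P and j = j, OF P(1)[OF j] w[unfolded \<Omega>_def]] a b by (simp add: \<rho>_def)
    next
      fix a w assume "a \<in> carrier (As j)" and w: "w \<in> \<Omega>"
      then show "\<rho> j a w \<in> \<Omega>"
        using truncated_act_closed[where P = P and j = j, OF P(1)[OF j] w[unfolded \<Omega>_def] j]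
        by (simp add: \<rho>_def \<Omega>_def)
    next
      fix w assume w: "w \<in> \<Omega>"
      show "\<rho> j \<one>\<^bsub>As j\<^esub> w = w"
        using truncated_act_one[where P = P and j = j, OF P(1)[OF j] w[unfolded \<Omega>_def]] by (simp add: \<rho>_def)
    qed (simp_all add: \<rho>_def \<Omega>_def c_def truncated_act_Nil truncated_words_def)
  qed
  have f: "f j \<in> quandle_hom (Q j) (perm_quandle \<Omega>)" if "j \<in> I" for j
    unfolding f_def by (rule as_perm_action.perm_hom[OF action[OF that]])
  obtain \<Phi> where \<Phi>: "\<Phi> \<in> quandle_hom F (perm_quandle \<Omega>)"
    and \<Phi>_incl: "\<And>i x. \<lbrakk>i \<in> I; x \<in> carrier (Q i)\<rbrakk> \<Longrightarrow> \<Phi> (incl i x) = f i x"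
    using free_product_hom_exists[OF quandle_perm_quandle f] by blast
  have \<Phi>_nf: "fst (\<Phi> (nf k' z w)) = map_option (foldr (\<lambda>(j, a). \<rho> j a) w) (c k')"
    if k': "k' \<in> I" "z \<in> carrier (Q k')" and "reduced I As k' w" for k' z w
    using that(3)
  proof (induction w)
    case Nil
    then show ?case
      using k' as_perm_action.perm_hom_def[OF action[OF k'(1)]]
      by (simp add: \<Phi>_incl f_def option.map_ident id_def)
  next
    case (Cons l w)
    obtain j a where l: "l = (j, a)" by fastforce
    have j: "j \<in> I" "a \<in> carrier (As j)" and w: "reduced I As k' w"
      using Cons.prems l by auto
    note nf = nf_closed[OF k' w]
    have "\<Phi> (nf k' z (l # w)) = as_act (perm_quandle \<Omega>) (f j) a (\<Phi> (nf k' z w))"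
      using as_act_natural[OF quandle_F incl_hom[OF j(1)] quandle_perm_quandle \<Phi> j(2) nf f[OF j(1)]]
        \<Phi>_incl[OF j(1)] l by simp
    then have "fst (\<Phi> (nf k' z (l # w))) = map_option (\<rho> j a) (fst (\<Phi> (nf k' z w)))"
      using as_perm_action.fst_as_act_perm_hom[OF action[OF j(1)] quandle_homD(1)[OF \<Phi> nf] j(2)]
      by (simp add: f_def)
    then show ?case
      using Cons.IH[OF w] by (simp add: l option.map_comp o_def)
  qed
  define h where "h = (\<lambda>(j, a). (j, \<alpha> j a))"
  have "inj_on h (set u \<union> set v)"
  proof (rule inj_onI)
    fix l l' assume l: "l \<in> set u \<union> set v" "l' \<in> set u \<union> set v" "h l = h l'"
    obtain j a where l_eq: "l = (j, a)" by fastforce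
    obtain b where l'_eq: "l' = (j, b)" using l(3) l_eq by (cases l') (auto simp: h_def)
    have "j \<in> I" using l(1) l_eq letters[OF u] letters[OF v] by blast
    then have "a = b"
      using l \<alpha>(2) by (auto simp: l_eq l'_eq h_def T_def dest!: inj_onD)
    then show "l = l'" by (simp add: l_eq l'_eq)
  qed
  then have h_inj: "map h u = map h v \<longleftrightarrow> u = v"
    by (rule inj_on_map_eq_map)
  \<comment> \<open>The maps to the finite groups keep these words reduced, and they have length at most \<open>N\<close>.\<close>
  have rebuild: "foldr (\<lambda>(j, a). \<rho> j a) w [] = map h w"
    if w: "reduced I As i w" "set w \<subseteq> set u \<union> set v" "length w \<le> N" for w
  proof -
    have "reduced I P i (map h w)"
      using w(1,2)
    proof (induction w)
      case (Cons l w)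
      obtain j a where l: "l = (j, a)" by fastforce
      have j: "j \<in> I" "a \<in> carrier (As j)" "a \<noteq> \<one>\<^bsub>As j\<^esub>" "j \<noteq> last_index i w"
        using Cons.prems l by auto
      interpret group_hom "As j" "P j" "\<alpha> j" by (rule \<alpha>_hom[OF j(1)])
      have "a \<in> T j" "\<one>\<^bsub>As j\<^esub> \<in> T j" using Cons.prems(2) l by (auto simp: T_def)
      then have "\<alpha> j a \<noteq> \<one>\<^bsub>P j\<^esub>"
        using inj_onD[OF \<alpha>(2)[OF j(1)], of a "\<one>\<^bsub>As j\<^esub>"] j(3) by auto
      moreover have "last_index i (map h w) = last_index i w"
        by (cases w) (auto simp: h_def)
      ultimately show ?case
        using Cons j by (simp add: l h_def)
    qed simp
    from foldr_truncated_act[OF this, of N] w(3)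
    have "foldr (\<lambda>(j, p). truncated_act P i N j p) (map h w) [] = map h w" by simp
    moreover have "foldr (\<lambda>(j, a). \<rho> j a) w [] = foldr (\<lambda>(j, p). truncated_act P i N j p) (map h w) []" for w
      by (induction w) (auto simp: h_def \<rho>_def)
    ultimately show ?thesis by simp
  qed
  have \<Phi>_u: "fst (\<Phi> (nf i x u)) = Some (map h u)"
    using \<Phi>_nf[OF i u] rebuild[OF u] by (simp add: c_def N_def)
  have "fst (\<Phi> (nf k y v)) \<noteq> Some (map h u)"
  proof (cases "k = i")
    case True
    then show ?thesis
      using \<Phi>_nf[OF k v] rebuild[of v] v neq h_inj by (auto simp: c_def N_def)
  next
    case False
    then show ?thesis using \<Phi>_nf[OF k v] by (simp add: c_def)
  qed
  then have ne: "\<Phi> (nf i x u) \<noteq> \<Phi> (nf k y v)" using \<Phi>_u by auto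
  have "finite \<Omega>"
    unfolding \<Omega>_def
  proof (rule finite_truncated_words)
    show "finite (fst ` (set u \<union> set v))" by simp
    fix j assume "j \<in> I - fst ` (set u \<union> set v)"
    then show "carrier (P j) = {\<one>\<^bsub>P j\<^esub>}" by (intro P_triv) (force simp: T_def)+
  qed (rule P(2))
  then show ?thesis
    using separated_by_nat_quandle[OF quandle_perm_quandle finite_perm_quandle \<Phi> ne]
      nf_closed[OF i u] nf_closed[OF k v] by blast
qed

end

theorem theorem4p4:
  fixes I :: "'i set"
    and Q :: "'i \<Rightarrow> 'a quandle"
    and X :: "'i \<Rightarrow> 'g set"
    and R :: "'i \<Rightarrow> ('g qterm \<times> 'g qterm) set"
  assumes "I \<noteq> {}"
    and "\<And>i. i \<in> I \<Longrightarrow> residually_finite_quandle (Q i)"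
    and "\<And>i. i \<in> I \<Longrightarrow> quandle_presentation (Q i) (X i) (R i)"
    and "disjoint_family_on X I"
    and "\<And>i. i \<in> I \<Longrightarrow> residually_finite_group (associated_group (Q i))"
  shows "residually_finite_quandle (quandle_free_product I X R)"
proof -
  interpret quandle_coproduct_groups I Q X R
  proof (intro quandle_coproduct_groups.intro quandle_coproduct.intro quandle_coproduct_groups_axioms.intro)
    show "quandle (Q i)" if "i \<in> I" for i
      using assms(2)[OF that] by (simp add: residually_finite_quandle_def)
    show "group (associated_group (Q i))" if "i \<in> I" for i
      using assms(5)[OF that] by (simp add: residually_finite_group_def)
  qed (rule assms(1,3,4), assumption?)+
  show ?thesis
    unfolding residually_finite_quandle_def
  proof (intro conjI quandle_F ballI impI)
    fix A B assume "A \<in> carrier F" "B \<in> carrier F" and neq: "A \<noteq> B"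
    then obtain i x u k y v where
      A: "i \<in> I" "x \<in> carrier (Q i)" "reduced I As i u" "A = nf i x u" and
      B: "k \<in> I" "y \<in> carrier (Q k)" "reduced I As k v" "B = nf k y v"
      using nf_exists by metis
    show "\<exists>(F' :: nat quandle) \<phi>. quandle F' \<and> finite (carrier F') \<and>
        \<phi> \<in> quandle_hom F F' \<and> \<phi> A \<noteq> \<phi> B"
    proof (cases "(i, u) = (k, v)")
      case True
      with A B neq show ?thesis
        using separate_base_points[OF A(1) assms(2)[OF A(1)] A(2) _ _ A(3), of y] by auto
    next
      case False
      show ?thesis
        unfolding A(4) B(4) by (rule separate_words[OF assms(5) A(1-3) B(1-3) False])
    qed
  qed
qed

end
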